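(* Let $B\in\mathbb{R}^{n\times r}$ have rows $b_1^{\mathsf T},\dots,b_n^{\mathsf T}$, and let $P_B=B^{\mathsf T}[-1,1]^n=\sum_{i=1}^n[-b_i,b_i]$. Let $m:=|\{i:b_i\ne0\}|$ and $d=\dim P_B$. If $d=0$, then $P_B$ is a singleton, so $|\operatorname{vert}(P_B)|=1$. If $d\ge1$, then $$|\operatorname{vert}(P_B)|\le2\sum_{j=0}^{d-1}\binom{m-1}{j}\le2\sum_{j=0}^{d-1}\binom{n-1}{j}=O(n^{d-1}),$$ where the last estimate is for fixed $d$. If the $m$ nonzero generators $b_i$ are in general linear position in $L:=\operatorname{lin}(P_B-P_B)$, equality holds in the first bound. Hence the problem $\max_{x\in\{\pm1\}^n}x^{\mathsf T}BB^{\mathsf T}x$ is solvable in polynomial time (in $n$) for fixed rank $r$.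
   Context: $\operatorname{vert}(P_B)$ is the vertex set of the polytope $P_B$, and $[-b_i,b_i]$ is the line segment, with sums meaning Minkowski sums. General linear position in the $d$-dimensional space $L$ means every subset of at most $d$ of the generators is linearly independent. Running time is counted in the real-arithmetic model. *)

theory Defs
  imports "HOL-Analysis.Analysis" "HOL-Library.Landau_Symbols"
    "HOL-Computational_Algebra.Polynomial"
begin

section \<open>Zonotopes\<close>

definition zonotope :: "real^'r^'n \<Rightarrow> (real^'r) set" where
  "zonotope B = (\<lambda>t. transpose B *v t) ` {t. \<forall>i. t $ i \<in> {-1..1}}"

definition vert :: "'a::real_vector set \<Rightarrow> 'a set" where
  "vert P = {v. v extreme_point_of P}"

(* The generators form a family, so a repeated vector counts as a linearly
   dependent pair; this is the role of injectivity below. *)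
definition general_linear_position ::
  "('i \<Rightarrow> 'a::euclidean_space) \<Rightarrow> 'i set \<Rightarrow> 'a set \<Rightarrow> bool" where
  "general_linear_position b A L \<longleftrightarrow>
     (\<forall>I \<subseteq> A. finite I \<and> card I \<le> dim L \<longrightarrow> inj_on b I \<and> independent (b ` I))"


section \<open>A real-arithmetic machine model\<close>

text \<open>
  A real RAM in the form of a structured programming language. The memory consists of
  registers holding natural numbers, used for counting and addressing, and of arrays of
  exact real numbers. Arithmetic and comparisons on reals, array accesses, and addition,
  subtraction and comparison of natural numbers each cost one step. There are no rounding
  operations, no multiplication of natural numbers, and the only real constants are
  integers; real values influence control flow and addressing only through comparisons.
  Subtraction of natural numbers is truncated, and division of a real by zero yields zero.
\<close>

record state =
  reg :: "nat \<Rightarrow> nat"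
  arr :: "nat \<Rightarrow> nat \<Rightarrow> real"

datatype iexp =
    INum nat
  | IReg nat
  | IAdd iexp iexp
  | ISub iexp iexp

datatype rexp =
    RNum int
  | RArr nat iexp
  | RAdd rexp rexp
  | RSub rexp rexp
  | RMul rexp rexp
  | RDiv rexp rexp

datatype bexp =
    ILess iexp iexp
  | RLess rexp rexp
  | BNot bexp
  | BAnd bexp bexp

datatype com =
    Skip
  | ISet nat iexp
  | RSet nat iexp rexp
  | Seq com com
  | Cond bexp com com
  | While bexp com

primrec ival :: "iexp \<Rightarrow> state \<Rightarrow> nat" where
  "ival (INum k) s = k"
| "ival (IReg x) s = reg s x"
| "ival (IAdd e f) s = ival e s + ival f s"
| "ival (ISub e f) s = ival e s - ival f s"

primrec rval :: "rexp \<Rightarrow> state \<Rightarrow> real" where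
  "rval (RNum k) s = of_int k"
| "rval (RArr a e) s = arr s a (ival e s)"
| "rval (RAdd e f) s = rval e s + rval f s"
| "rval (RSub e f) s = rval e s - rval f s"
| "rval (RMul e f) s = rval e s * rval f s"
| "rval (RDiv e f) s = rval e s / rval f s"

primrec bval :: "bexp \<Rightarrow> state \<Rightarrow> bool" where
  "bval (ILess e f) s \<longleftrightarrow> ival e s < ival f s"
| "bval (RLess e f) s \<longleftrightarrow> rval e s < rval f s"
| "bval (BNot b) s \<longleftrightarrow> \<not> bval b s"
| "bval (BAnd b c) s \<longleftrightarrow> bval b s \<and> bval c s"

primrec icost :: "iexp \<Rightarrow> nat" where
  "icost (INum k) = 1"
| "icost (IReg x) = 1"
| "icost (IAdd e f) = 1 + icost e + icost f"
| "icost (ISub e f) = 1 + icost e + icost f"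

primrec rcost :: "rexp \<Rightarrow> nat" where
  "rcost (RNum k) = 1"
| "rcost (RArr a e) = 1 + icost e"
| "rcost (RAdd e f) = 1 + rcost e + rcost f"
| "rcost (RSub e f) = 1 + rcost e + rcost f"
| "rcost (RMul e f) = 1 + rcost e + rcost f"
| "rcost (RDiv e f) = 1 + rcost e + rcost f"

primrec bcost :: "bexp \<Rightarrow> nat" where
  "bcost (ILess e f) = 1 + icost e + icost f"
| "bcost (RLess e f) = 1 + rcost e + rcost f"
| "bcost (BNot b) = 1 + bcost b"
| "bcost (BAnd b c) = 1 + bcost b + bcost c"

(* exec c s t s': program c, started in state s, halts after exactly t steps in state s'. *)
inductive exec :: "com \<Rightarrow> state \<Rightarrow> nat \<Rightarrow> state \<Rightarrow> bool" where
  Skip: "exec Skip s 1 s"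
| ISet: "exec (ISet x e) s (1 + icost e) (s\<lparr>reg := (reg s)(x := ival e s)\<rparr>)"
| RSet: "exec (RSet a e f) s (1 + icost e + rcost f)
          (s\<lparr>arr := (arr s)(a := (arr s a)(ival e s := rval f s))\<rparr>)"
| Seq: "exec c s t s' \<Longrightarrow> exec d s' u s'' \<Longrightarrow> exec (Seq c d) s (t + u) s''"
| CondT: "bval b s \<Longrightarrow> exec c s t s' \<Longrightarrow> exec (Cond b c d) s (bcost b + t) s'"
| CondF: "\<not> bval b s \<Longrightarrow> exec d s t s' \<Longrightarrow> exec (Cond b c d) s (bcost b + t) s'"
| WhileF: "\<not> bval b s \<Longrightarrow> exec (While b c) s (bcost b) s"
| WhileT: "bval b s \<Longrightarrow> exec c s t s' \<Longrightarrow> exec (While b c) s' u s'' \<Longrightarrow>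
            exec (While b c) s (bcost b + t + u) s''"

inductive_cases SkipE: "exec Skip s t s'"
inductive_cases ISetE: "exec (ISet x e) s t s'"
inductive_cases RSetE: "exec (RSet a e f) s t s'"
inductive_cases SeqE: "exec (Seq c d) s t s'"
inductive_cases CondE: "exec (Cond b c d) s t s'"
inductive_cases WhileE: "exec (While b c) s t s'"

lemma exec_deterministic:
  "exec c s t s' \<Longrightarrow> exec c s u s'' \<Longrightarrow> u = t \<and> s'' = s'"
proof (induction arbitrary: u s'' rule: exec.induct)
  case (Skip s)
  then show ?case by (rule SkipE) simp
next
  case (ISet s x e)
  then show ?case by (rule ISetE) simp
next
  case (RSet s a e f)
  then show ?case by (rule RSetE) simp
next
  case (Seq c s t s1 d v s2)
  from Seq.prems obtain t' s1' v' where
    "exec c s t' s1'" "exec d s1' v' s''" "u = t' + v'" by (rule SeqE)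
  moreover from this have "t' = t" "s1' = s1" using Seq.IH(1) by simp_all
  ultimately show ?case using Seq.IH(2) by simp
next
  case (CondT b s c t s1 d)
  from CondT.prems CondT.hyps obtain t' where
    "exec c s t' s''" "u = bcost b + t'" by (elim CondE) simp_all
  then show ?case using CondT.IH by simp
next
  case (CondF b s d t s1 c)
  from CondF.prems CondF.hyps obtain t' where
    "exec d s t' s''" "u = bcost b + t'" by (elim CondE) simp_all
  then show ?case using CondF.IH by simp
next
  case (WhileF b s c)
  from WhileF.prems show ?case by (rule WhileE) (simp_all add: WhileF.hyps)
next
  case (WhileT b s c t s1 v s2)
  from WhileT.prems obtain t' s1' v' where
    "exec c s t' s1'" "exec (While b c) s1' v' s''" "u = bcost b + t' + v'"
    by (rule WhileE) (simp_all add: WhileT.hyps)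
  moreover from this have "t' = t" "s1' = s1" using WhileT.IH(1) by simp_all
  ultimately show ?case using WhileT.IH(2) by simp
qed

(* A single program must solve all instances (there is no advice depending on the size). *)
definition polytime_solvable ::
  "('a \<Rightarrow> nat) \<Rightarrow> ('a \<Rightarrow> state) \<Rightarrow> ('a \<Rightarrow> state \<Rightarrow> bool) \<Rightarrow> bool" where
  "polytime_solvable size_of input correct \<longleftrightarrow>
     (\<exists>c (p :: nat poly). \<forall>x. \<exists>t s. exec c (input x) t s \<and> t \<le> poly p (size_of x) \<and> correct x s)"


section \<open>The quadratic sign problem\<close>

text \<open>
  Here the number of rows varies inside a single statement, so an \<open>n\<close>-by-\<open>r\<close> matrix is a
  function on indices, of which only the entries with \<open>i < n\<close> and \<open>j < r\<close> are used.
\<close>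

(* x^T B B^T x, where (B B^T)_ik is the inner product of rows i and k *)
definition quad_form :: "nat \<Rightarrow> nat \<Rightarrow> (nat \<Rightarrow> nat \<Rightarrow> real) \<Rightarrow> (nat \<Rightarrow> real) \<Rightarrow> real" where
  "quad_form r n B x = (\<Sum>i<n. \<Sum>k<n. x i * (\<Sum>j<r. B i j * B k j) * x k)"

definition sign_vector :: "nat \<Rightarrow> (nat \<Rightarrow> real) \<Rightarrow> bool" where
  "sign_vector n x \<longleftrightarrow> (\<forall>i<n. x i \<in> {-1, 1})"

(* Register 0 holds n and array 0 holds B in row-major order; all else is zero. *)
definition quad_input :: "nat \<Rightarrow> nat \<Rightarrow> (nat \<Rightarrow> nat \<Rightarrow> real) \<Rightarrow> state" where
  "quad_input r n B =
     \<lparr>reg = (\<lambda>_. 0)(0 := n),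
      arr = (\<lambda>_ _. 0)(0 := (\<lambda>k. if k < n * r then B (k div r) (k mod r) else 0))\<rparr>"

(* On halting, array 1 holds a maximizer and cell 0 of array 2 holds the maximum. *)
definition quad_output :: "nat \<Rightarrow> nat \<Rightarrow> (nat \<Rightarrow> nat \<Rightarrow> real) \<Rightarrow> state \<Rightarrow> bool" where
  "quad_output r n B s \<longleftrightarrow>
     sign_vector n (arr s 1) \<and>
     (\<forall>y. sign_vector n y \<longrightarrow> quad_form r n B y \<le> quad_form r n B (arr s 1)) \<and>
     arr s 2 0 = quad_form r n B (arr s 1)"

definition quad_max_polytime :: "nat \<Rightarrow> bool" where
  "quad_max_polytime r \<longleftrightarrow>
     polytime_solvable (\<lambda>(n, B). n) (\<lambda>(n, B). quad_input r n B) (\<lambda>(n, B). quad_output r n B)"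

end

theory Submission
  imports Defs
begin

text \<open>
  The vertices of the zonotope correspond to the strict sign patterns \<open>(sgn (u \<bullet> b\<^sub>i))\<^sub>i\<close> of its
  nonzero generators. Fix a generator \<open>b\<^sub>e\<close> and keep the patterns that are positive at \<open>e\<close>, which
  by antipodality is half of them. If they shatter \<open>T\<close>, then the generators in \<open>T \<union> {e}\<close> are
  linearly independent, so \<open>T\<close> has fewer than \<open>d\<close> elements, and Pajor's form of the Sauer-Shelah
  lemma gives the upper bound. In general position every \<open>T\<close> with fewer than \<open>d\<close> elements is even
  strongly shattered (perturb a \<open>u\<close> that is orthogonal to exactly the generators in \<open>T\<close>), and the
  number of strongly shattered sets is a lower bound.

  A maximizer \<open>x\<close> of the quadratic form satisfies \<open>x\<^sub>i = sgn (b\<^sub>i \<bullet> u)\<close> with \<open>u = B\<^sup>T x\<close> for every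
  nonzero row, so it is a strict sign pattern. All of these are found, with at most \<open>(2n)\<^sup>r\<close>
  candidates, by Gaussian elimination that tries every row as the pivot in every column.
\<close>

text \<open>Halving is what makes the count sharp. All strict patterns together shatter only
  independent sets, so the same argument without a fixed sign would give the sum of
  \<open>m choose j\<close> for j up to d, which is too large by \<open>(m - 1) choose d\<close>.
  Fixing the sign at \<open>e\<close> takes one element from the ground set and, at the same time,
  one from the admissible size of a shattered set. The shattering bound treats degenerate
  configurations directly, repeated and parallel generators included. For the algorithm, degeneracy
  is the obstacle: on the hyperplane of a pivot row, every row that vanishes there has lost its
  sign. Approaching that hyperplane from a generic point confines the loss to rows parallel to the
  pivot, whose signs all follow from the sign of the pivot. One guessed bit per level therefore
  suffices, which is the factor 2 in each of the r levels.\<close>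

section \<open>Small perturbations that preserve signs\<close>

lemma eventually_sgn_add:
  fixes a b :: real
  assumes "a \<noteq> 0"
  shows "\<forall>\<^sub>F d in at_right 0. sgn (a + d * b) = sgn a"
proof -
  have lim: "((\<lambda>d. a + d * b) \<longlongrightarrow> a) (at_right 0)"
    by (rule tendsto_eq_intros | simp)+
  show ?thesis
  proof (cases "a > 0")
    case True
    then have "\<forall>\<^sub>F d in at_right 0. a + d * b > 0" by (rule order_tendstoD(1)[OF lim])
    then show ?thesis by eventually_elim (use True in simp)
  next
    case False
    with assms have "a < 0" by simp
    then have "\<forall>\<^sub>F d in at_right 0. a + d * b < 0" by (rule order_tendstoD(2)[OF lim])
    then show ?thesis by eventually_elim (use \<open>a < 0\<close> in simp)
  qed
qed

lemma small_step_preserves_sgn: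
  fixes a b :: "'i \<Rightarrow> real"
  assumes "finite I"
  obtains d where "d > 0" "\<And>i. i \<in> I \<Longrightarrow> a i \<noteq> 0 \<Longrightarrow> sgn (a i + d * b i) = sgn (a i)"
proof -
  have "\<forall>\<^sub>F d in at_right 0. \<forall>i\<in>I. a i \<noteq> 0 \<longrightarrow> sgn (a i + d * b i) = sgn (a i)"
    using assms eventually_sgn_add by (intro eventually_ball_finite) auto
  then have "\<forall>\<^sub>F d in at_right 0. d > 0 \<and> (\<forall>i\<in>I. a i \<noteq> 0 \<longrightarrow> sgn (a i + d * b i) = sgn (a i))"
    using eventually_at_right_less[of 0] by eventually_elim auto
  from eventually_happens'[OF trivial_limit_at_right_real this] that show ?thesis by blast
qed

text \<open>The forms are made nonzero one at a time, each by a step along a vector on which it does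
  not vanish, short enough to change no nonzero sign; nothing gained earlier is lost. The abstract
  \<open>shift\<close> lets this serve both for Euclidean vectors and for coefficient functions on
  indices.\<close>

lemma generic_perturbation:
  fixes f :: "'i \<Rightarrow> 'v \<Rightarrow> real" and shift :: "'v \<Rightarrow> real \<Rightarrow> 'v \<Rightarrow> 'v"
  assumes "finite I" "u \<in> V"
    and clos: "\<And>u v d. u \<in> V \<Longrightarrow> v \<in> V \<Longrightarrow> shift u d v \<in> V"
    and lin: "\<And>i u d v. i \<in> I \<Longrightarrow> f i (shift u d v) = f i u + d * f i v"
    and nz: "\<And>i. i \<in> I \<Longrightarrow> \<exists>v\<in>V. f i v \<noteq> 0"
  shows "\<exists>w\<in>V. \<forall>i\<in>I. f i w \<noteq> 0 \<and> (f i u \<noteq> 0 \<longrightarrow> sgn (f i w) = sgn (f i u))"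
proof -
  have "\<exists>w\<in>V. (\<forall>i\<in>J. f i w \<noteq> 0) \<and> (\<forall>i\<in>I. f i u \<noteq> 0 \<longrightarrow> sgn (f i w) = sgn (f i u))"
    if "finite J" "J \<subseteq> I" for J
    using that
  proof (induction J rule: finite_induct)
    case empty
    then show ?case using \<open>u \<in> V\<close> by auto
  next
    case (insert j J)
    then obtain w where w: "w \<in> V" "\<forall>i\<in>J. f i w \<noteq> 0"
      "\<forall>i\<in>I. f i u \<noteq> 0 \<longrightarrow> sgn (f i w) = sgn (f i u)" by auto
    from insert.prems nz obtain v where v: "v \<in> V" "f j v \<noteq> 0" by auto
    obtain d where d: "d > 0"
      "\<And>i. i \<in> I \<Longrightarrow> f i w \<noteq> 0 \<Longrightarrow> sgn (f i w + d * f i v) = sgn (f i w)"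
      using small_step_preserves_sgn[OF \<open>finite I\<close>, of "\<lambda>i. f i w" "\<lambda>i. f i v"] by blast
    have "f i (shift w d v) \<noteq> 0" if "i \<in> I" "f i w \<noteq> 0" for i
      using d(2)[OF that] that by (metis lin sgn_zero_iff)
    moreover have "f j (shift w d v) \<noteq> 0"
      by (cases "f j w = 0") (use calculation lin insert.prems d v in auto)
    moreover have "sgn (f i (shift w d v)) = sgn (f i u)" if "i \<in> I" "f i u \<noteq> 0" for i
      using d(2)[of i] w(3) that by (metis lin sgn_zero_iff)
    ultimately show ?case
      using clos[OF w(1) v(1)] w(2) insert.prems by blast
  qed
  from this[of I] \<open>finite I\<close> show ?thesis by auto
qed

section \<open>Shattering\<close>

definition shatters :: "'a set set \<Rightarrow> 'a set \<Rightarrow> bool" where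
  "shatters F T \<longleftrightarrow> (\<forall>A\<subseteq>T. \<exists>S\<in>F. S \<inter> T = A)"

text \<open>\<open>F\<close> contains a full subcube in the directions of \<open>T\<close>;
  \<open>R\<close> is its bottom vertex.\<close>

definition strongly_shatters :: "'a set set \<Rightarrow> 'a set \<Rightarrow> bool" where
  "strongly_shatters F T \<longleftrightarrow> (\<exists>R. R \<inter> T = {} \<and> (\<forall>A\<subseteq>T. R \<union> A \<in> F))"

text \<open>Deleting \<open>x\<close> identifies exactly the pairs \<open>S\<close>,
  \<open>insert x S\<close> that both lie in \<open>F\<close>; the second summand counts these
  collisions.\<close>

lemma card_eq_trace_plus_link:
  assumes "finite F"
  shows "card F = card ((\<lambda>S. S - {x}) ` F) + card {S \<in> F. x \<notin> S \<and> insert x S \<in> F}"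
proof -
  let ?P = "{S \<in> F. x \<notin> S}" and ?Q = "{S \<in> F. x \<in> S}"
  let ?Q' = "(\<lambda>S. S - {x}) ` ?Q"
  have "inj_on (\<lambda>S. S - {x}) ?Q"
    by (rule inj_on_inverseI[where g = "insert x"]) auto
  then have "card ?Q' = card ?Q" by (rule card_image)
  moreover have "card F = card ?P + card ?Q"
    using assms by (subst card_Un_disjoint[symmetric]) (auto intro: arg_cong[where f = card])
  moreover have "(\<lambda>S. S - {x}) ` F = ?P \<union> ?Q'"
  proof -
    have "(\<lambda>S. S - {x}) ` ?P = id ` ?P" by (rule image_cong) auto
    then have "(\<lambda>S. S - {x}) ` (?P \<union> ?Q) = ?P \<union> ?Q'" by (simp only: image_Un image_id id_apply)
    moreover have "?P \<union> ?Q = F" by auto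
    ultimately show ?thesis by (simp only:)
  qed
  moreover have "{S \<in> F. x \<notin> S \<and> insert x S \<in> F} = ?P \<inter> ?Q'"
  proof (intro equalityI subsetI)
    fix S assume "S \<in> {S \<in> F. x \<notin> S \<and> insert x S \<in> F}"
    then show "S \<in> ?P \<inter> ?Q'" by (auto intro!: image_eqI[of _ _ "insert x S"])
  qed (auto simp: insert_absorb)
  moreover have "card ?P + card ?Q' = card (?P \<union> ?Q') + card (?P \<inter> ?Q')"
    using assms by (intro card_Un_Int) auto
  ultimately show ?thesis by (simp only:)
qed

lemma card_Pow_insert_split:
  assumes "finite X" "x \<notin> X"
  shows "card {T. T \<subseteq> insert x X \<and> P T} =
    card {T. T \<subseteq> X \<and> P T} + card {T. T \<subseteq> X \<and> P (insert x T)}"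
proof -
  have "inj_on (insert x) {T. T \<subseteq> X \<and> P (insert x T)}"
    using assms(2) by (intro inj_on_inverseI[where g = "\<lambda>S. S - {x}"]) auto
  then have "card (insert x ` {T. T \<subseteq> X \<and> P (insert x T)}) = card {T. T \<subseteq> X \<and> P (insert x T)}"
    by (rule card_image)
  moreover have "{T. T \<subseteq> insert x X \<and> P T} =
      {T. T \<subseteq> X \<and> P T} \<union> insert x ` {T. T \<subseteq> X \<and> P (insert x T)}"
  proof (intro equalityI subsetI)
    fix T assume T: "T \<in> {T. T \<subseteq> insert x X \<and> P T}"
    show "T \<in> {T. T \<subseteq> X \<and> P T} \<union> insert x ` {T. T \<subseteq> X \<and> P (insert x T)}"
    proof (cases "x \<in> T")
      case True
      then have "T = insert x (T - {x})" by auto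
      with T show ?thesis by (auto intro!: image_eqI[where x = "T - {x}"])
    qed (use T in auto)
  qed auto
  moreover have "{T. T \<subseteq> X \<and> P T} \<inter> insert x ` {T. T \<subseteq> X \<and> P (insert x T)} = {}"
    using assms(2) by auto
  ultimately show ?thesis
    using assms(1) by (simp add: card_Un_disjoint)
qed

text \<open>Induction on the ground set, with \<open>F\<close> split into its trace and its link at
  \<open>x\<close>. A set shattered by the trace is shattered by \<open>F\<close>, and one shattered
  by the link remains so after adding \<open>x\<close>; for strong shattering both implications run
  the other way. So the two counts are super- and subadditive under a split for which
  \<open>card F\<close> is additive.\<close>

lemma shattering_sandwich:
  assumes "finite X" "F \<subseteq> Pow X"
  shows "card F \<le> card {T. T \<subseteq> X \<and> shatters F T} \<and>
    card {T. T \<subseteq> X \<and> strongly_shatters F T} \<le> card F"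
  using assms
proof (induction X arbitrary: F rule: finite_induct)
  case empty
  then have "F = {} \<or> F = {{}}" by auto
  then show ?case
    by (auto simp: shatters_def strongly_shatters_def cong: conj_cong)
next
  case (insert x X)
  have "finite F" using insert.prems insert.hyps(1) by (meson finite_Pow_iff finite_insert finite_subset)
  let ?F0 = "(\<lambda>S. S - {x}) ` F" and ?F1 = "{S \<in> F. x \<notin> S \<and> insert x S \<in> F}"
  have sub: "?F0 \<subseteq> Pow X" "?F1 \<subseteq> Pow X" using insert.prems insert.hyps by auto
  have fin: "finite {T. T \<subseteq> X \<and> P T}" for P using insert.hyps(1) by simp
  have sh0: "shatters F T" if "T \<subseteq> X" "shatters ?F0 T" for T
    unfolding shatters_def
  proof (intro allI impI)
    fix A assume "A \<subseteq> T"
    with that(2) obtain S where "S \<in> F" "(S - {x}) \<inter> T = A"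
      by (auto simp: shatters_def)
    moreover have "x \<notin> T" using that(1) insert.hyps by auto
    ultimately show "\<exists>S\<in>F. S \<inter> T = A" by auto
  qed
  have sh1: "shatters F (insert x T)" if "T \<subseteq> X" "shatters ?F1 T" for T
    unfolding shatters_def
  proof (intro allI impI)
    fix A assume A: "A \<subseteq> insert x T"
    then have "A - {x} \<subseteq> T" by auto
    with that(2) obtain S where S: "S \<in> ?F1" "S \<inter> T = A - {x}"
      unfolding shatters_def by blast
    have "x \<notin> T" using that(1) insert.hyps by auto
    show "\<exists>S\<in>F. S \<inter> insert x T = A"
    proof (cases "x \<in> A")
      case True
      then show ?thesis using S by (intro bexI[of _ "insert x S"]) auto
    next
      case False
      then show ?thesis using S A by (intro bexI[of _ S]) auto
    qed
  qed
  have st0: "strongly_shatters ?F0 T" if "T \<subseteq> X" and st: "strongly_shatters F T" for T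
  proof -
    from st obtain R where R: "R \<inter> T = {}" "\<forall>A\<subseteq>T. R \<union> A \<in> F"
      by (auto simp: strongly_shatters_def)
    have "(R - {x}) \<union> A \<in> ?F0" if "A \<subseteq> T" for A
      using R(2) that \<open>T \<subseteq> X\<close> insert.hyps by (intro image_eqI[of _ _ "R \<union> A"]) auto
    then show ?thesis using R(1) unfolding strongly_shatters_def by (intro exI[of _ "R - {x}"]) auto
  qed
  have st1: "strongly_shatters ?F1 T" if "T \<subseteq> X" and st: "strongly_shatters F (insert x T)" for T
  proof -
    from st obtain R where R: "R \<inter> insert x T = {}" "\<forall>A\<subseteq>insert x T. R \<union> A \<in> F"
      by (auto simp: strongly_shatters_def)
    have "R \<union> A \<in> ?F1" if "A \<subseteq> T" for A
    proof -
      have "R \<union> A \<in> F" "insert x (R \<union> A) \<in> F"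
        using R(2) that by (auto dest: spec[of _ "insert x A"])
      then show ?thesis using R(1) that \<open>T \<subseteq> X\<close> insert.hyps by auto
    qed
    then show ?thesis using R(1) unfolding strongly_shatters_def by auto
  qed
  have "card {T. T \<subseteq> X \<and> shatters ?F0 T} \<le> card {T. T \<subseteq> X \<and> shatters F T}"
    "card {T. T \<subseteq> X \<and> shatters ?F1 T} \<le> card {T. T \<subseteq> X \<and> shatters F (insert x T)}"
    "card {T. T \<subseteq> X \<and> strongly_shatters F T} \<le> card {T. T \<subseteq> X \<and> strongly_shatters ?F0 T}"
    "card {T. T \<subseteq> X \<and> strongly_shatters F (insert x T)} \<le> card {T. T \<subseteq> X \<and> strongly_shatters ?F1 T}"
    by (intro card_mono fin; use sh0 sh1 st0 st1 in blast)+
  then show ?case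
    using insert.IH[OF sub(1)] insert.IH[OF sub(2)] card_eq_trace_plus_link[OF \<open>finite F\<close>, of x]
    by (simp add: card_Pow_insert_split[OF insert.hyps])
qed

lemma card_subsets_card_le:
  assumes "finite X"
  shows "card {T. T \<subseteq> X \<and> card T \<le> k} = (\<Sum>j=0..k. card X choose j)"
proof -
  have "{T. T \<subseteq> X \<and> card T \<le> k} = (\<Union>j\<in>{0..k}. {T. T \<subseteq> X \<and> card T = j})"
    by auto
  then show ?thesis
    using assms by (simp add: card_UN_disjoint disjoint_iff n_subsets)
qed

section \<open>Sign patterns of a vector configuration\<close>

definition strict_patterns :: "('i \<Rightarrow> 'a::euclidean_space) \<Rightarrow> 'i set \<Rightarrow> 'i set set" where
  "strict_patterns b I = {{i \<in> I. u \<bullet> b i > 0} |u. \<forall>i\<in>I. u \<bullet> b i \<noteq> 0}"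

text \<open>The index \<open>e\<close> is dropped from the patterns since its sign is fixed; this is
  the origin of \<open>m - 1\<close> in the bounds.\<close>

definition half_patterns :: "('i \<Rightarrow> 'a::euclidean_space) \<Rightarrow> 'i set \<Rightarrow> 'i \<Rightarrow> 'i set set" where
  "half_patterns b I e = {{i \<in> I - {e}. u \<bullet> b i > 0} |u. (\<forall>i\<in>I. u \<bullet> b i \<noteq> 0) \<and> u \<bullet> b e > 0}"

lemma card_strict_patterns:
  assumes "finite I" "e \<in> I"
  shows "card (strict_patterns b I) = 2 * card (half_patterns b I e)"
proof -
  let ?S = "strict_patterns b I" and ?H = "half_patterns b I e"
  let ?P = "insert e ` ?H" and ?N = "(\<lambda>A. I - insert e A) ` ?H"
  have sub: "A \<subseteq> I - {e}" if "A \<in> ?H" for A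
    using that by (auto simp: half_patterns_def)
  have "?S = ?P \<union> ?N"
  proof (intro equalityI subsetI)
    fix A assume "A \<in> ?S"
    then obtain u where u: "\<forall>i\<in>I. u \<bullet> b i \<noteq> 0" and A: "A = {i \<in> I. u \<bullet> b i > 0}"
      by (auto simp: strict_patterns_def)
    show "A \<in> ?P \<union> ?N"
    proof (cases "u \<bullet> b e > 0")
      case True
      then have "{i \<in> I - {e}. u \<bullet> b i > 0} \<in> ?H" using u by (auto simp: half_patterns_def)
      moreover have "A = insert e {i \<in> I - {e}. u \<bullet> b i > 0}" using True A assms by auto
      ultimately show ?thesis by blast
    next
      case False
      then have "u \<bullet> b e < 0" using u assms(2) by force
      then have "{i \<in> I - {e}. (- u) \<bullet> b i > 0} \<in> ?H"
        using u unfolding half_patterns_def by (intro CollectI exI[of _ "- u"]) auto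
      moreover have "A = I - insert e {i \<in> I - {e}. (- u) \<bullet> b i > 0}"
        using False A u assms by (auto simp: not_less le_less)
      ultimately show ?thesis by blast
    qed
  next
    fix A assume "A \<in> ?P \<union> ?N"
    then obtain u where u: "\<forall>i\<in>I. u \<bullet> b i \<noteq> 0" "u \<bullet> b e > 0"
      and A: "A = insert e {i \<in> I - {e}. u \<bullet> b i > 0} \<or>
              A = I - insert e {i \<in> I - {e}. u \<bullet> b i > 0}"
      by (auto simp: half_patterns_def)
    from A show "A \<in> ?S"
    proof
      assume "A = insert e {i \<in> I - {e}. u \<bullet> b i > 0}"
      also have "\<dots> = {i \<in> I. u \<bullet> b i > 0}" using u assms by auto
      finally show ?thesis using u by (auto simp: strict_patterns_def)
    next
      assume "A = I - insert e {i \<in> I - {e}. u \<bullet> b i > 0}"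
      also have "\<dots> = {i \<in> I. (- u) \<bullet> b i > 0}" using u assms by (auto simp: not_less le_less)
      finally show ?thesis using u unfolding strict_patterns_def
        by (intro CollectI exI[of _ "- u"]) auto
    qed
  qed
  moreover have "?P \<inter> ?N = {}" by auto
  moreover have "inj_on (insert e) ?H"
    using sub by (intro inj_on_inverseI[where g = "\<lambda>A. A - {e}"]) auto
  moreover have "inj_on (\<lambda>A. I - insert e A) ?H"
    using sub assms by (intro inj_on_inverseI[where g = "\<lambda>A. I - insert e A"]) auto
  moreover have "finite ?H"
    using sub assms(1) by (intro finite_subset[of ?H "Pow I"]) auto
  ultimately show ?thesis by (simp add: card_Un_disjoint card_image)
qed

lemma independent_familyI:
  fixes b :: "'i \<Rightarrow> 'a::real_vector"
  assumes "finite T" and lin: "\<And>c. (\<Sum>i\<in>T. c i *\<^sub>R b i) = 0 \<Longrightarrow> \<forall>i\<in>T. c i = 0"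
  shows "inj_on b T" "independent (b ` T)"
proof -
  show inj: "inj_on b T"
  proof (rule inj_onI, rule ccontr)
    fix i j assume ij: "i \<in> T" "j \<in> T" "b i = b j" "i \<noteq> j"
    \<comment> \<open>A repeated vector is a linear relation with coefficients 1 and -1.\<close>
    let ?c = "\<lambda>l. (if l = i then 1 else 0) - (if l = j then 1 else (0::real))"
    have "(\<Sum>l\<in>T. ?c l *\<^sub>R b l) = b i - b j"
      using ij \<open>finite T\<close> by (simp add: scaleR_left_diff_distrib sum_subtractf if_distrib[where f = "\<lambda>c. c *\<^sub>R _"] cong: if_cong)
    then have "?c i = 0" using ij lin[of ?c] by auto
    then show False using ij by simp
  qed
  have "c v = 0" if "(\<Sum>v\<in>b ` T. c v *\<^sub>R v) = 0" "v \<in> b ` T" for c v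
    using that lin[of "c \<circ> b"] inj by (auto simp: sum.reindex)
  then show "independent (b ` T)"
    using \<open>finite T\<close> by (auto simp: dependent_finite)
qed

text \<open>Given a linear relation on \<open>insert e T\<close>, shattering provides a
  \<open>u\<close> whose signs match the coefficients. Pairing the relation with \<open>u\<close>
  yields a vanishing sum of nonnegative terms, and as no \<open>u \<bullet> b i\<close> is zero, all
  coefficients are. The inequality is strict because \<open>e\<close> joins \<open>T\<close> in the
  independent family.\<close>

lemma half_patterns_shatters_card:
  fixes b :: "'i \<Rightarrow> 'a::euclidean_space"
  assumes "finite I" "e \<in> I" "T \<subseteq> I - {e}" and sh: "shatters (half_patterns b I e) T"
  shows "card T < dim (b ` I)"
proof -
  have fT: "finite T" using assms(1,3) finite_subset by blast
  have eT: "e \<notin> T" using assms(3) by auto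
  have pos: "\<forall>i\<in>insert e T. c i = 0"
    if c0: "(\<Sum>i\<in>insert e T. c i *\<^sub>R b i) = 0" and ce: "c e \<ge> 0" for c :: "'i \<Rightarrow> real"
  proof -
    from sh have "\<exists>S\<in>half_patterns b I e. S \<inter> T = {i \<in> T. c i > 0}"
      unfolding shatters_def by auto
    then obtain u where u: "\<forall>i\<in>I. u \<bullet> b i \<noteq> 0" "u \<bullet> b e > 0"
      and S: "{i \<in> I - {e}. u \<bullet> b i > 0} \<inter> T = {i \<in> T. c i > 0}"
      by (auto simp: half_patterns_def)
    have nn: "c i * (u \<bullet> b i) \<ge> 0" if "i \<in> insert e T" for i
    proof (cases "i = e")
      case True
      then show ?thesis using ce u(2) by simp
    next
      case False
      then have i: "i \<in> T" "i \<in> I - {e}" using that assms(3) by auto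
      then have "u \<bullet> b i > 0 \<longleftrightarrow> c i > 0" using S by blast
      then show ?thesis by (cases "c i > 0") (auto simp: mult_nonpos_nonpos)
    qed
    have "(\<Sum>i\<in>insert e T. c i * (u \<bullet> b i)) = u \<bullet> (\<Sum>i\<in>insert e T. c i *\<^sub>R b i)"
      by (simp only: inner_sum_right inner_scaleR_right)
    with c0 have "(\<Sum>i\<in>insert e T. c i * (u \<bullet> b i)) = 0" by (simp only: inner_zero_right)
    then have "\<forall>i\<in>insert e T. c i * (u \<bullet> b i) = 0"
      using nn fT by (subst (asm) sum_nonneg_eq_0_iff) auto
    then show ?thesis using u(1) assms(2,3) by auto
  qed
  have "\<forall>i\<in>insert e T. c i = 0" if "(\<Sum>i\<in>insert e T. c i *\<^sub>R b i) = 0" for c :: "'i \<Rightarrow> real"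
  \<comment> \<open>The sign of \<open>u\<close> at \<open>e\<close> is fixed as positive, so a
    relation with negative coefficient at \<open>e\<close> is negated first.\<close>
  proof (cases "c e \<ge> 0")
    case True
    with pos that show ?thesis by blast
  next
    case False
    have "(\<Sum>i\<in>insert e T. (- c i) *\<^sub>R b i) = - (\<Sum>i\<in>insert e T. c i *\<^sub>R b i)"
      by (simp only: scaleR_minus_left sum_negf)
    with that have "(\<Sum>i\<in>insert e T. (- c i) *\<^sub>R b i) = 0" by (simp only: minus_zero)
    from pos[OF this] False show ?thesis by simp
  qed
  then have "inj_on b (insert e T)" "independent (b ` insert e T)"
    using independent_familyI[of "insert e T" b] fT by blast+
  then have "card (insert e T) = dim (b ` insert e T)"
    by (metis card_image dim_eq_card_independent)
  also have "\<dots> \<le> dim (b ` I)" using assms(2,3) by (intro dim_subset) auto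
  finally show ?thesis using fT eT by simp
qed

section \<open>Functionals with prescribed signs, and the two pattern counts\<close>

lemma functional_prescribed_on_independent:
  fixes S :: "'a::euclidean_space set"
  assumes "independent S"
  shows "\<exists>v. \<forall>x\<in>S. v \<bullet> x = h x"
proof -
  obtain g :: "'a \<Rightarrow> real" where g: "linear g" "\<forall>x\<in>S. g x = h x"
    using linear_independent_extend[OF assms] by blast
  \<comment> \<open>The functional \<open>g\<close> is represented as an inner product with the
    vector \<open>adjoint g 1\<close>.\<close>
  have "adjoint g 1 \<bullet> x = g x" for x
    using adjoint_works[OF g(1), of x 1] by (simp add: inner_commute)
  with g(2) show ?thesis by (intro exI[of _ "adjoint g 1"]) simp
qed

text \<open>The component \<open>z\<close> of \<open>b i\<close> orthogonal to \<open>span S\<close>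
  is nonzero and satisfies \<open>z \<bullet> b i = z \<bullet> z\<close>, so no form
  \<open>u \<bullet> b i\<close> vanishes on the whole orthogonal complement. The perturbation can
  thus start from 0, where there is no sign to preserve.\<close>

lemma generic_orthogonal_vector:
  fixes b :: "'i \<Rightarrow> 'a::euclidean_space"
  assumes "finite I" and "\<And>i. i \<in> I \<Longrightarrow> b i \<notin> span S"
  obtains u where "\<And>x. x \<in> S \<Longrightarrow> u \<bullet> x = 0" "\<And>i. i \<in> I \<Longrightarrow> u \<bullet> b i \<noteq> 0"
proof -
  let ?V = "{u. \<forall>x\<in>S. u \<bullet> x = 0}"
  have ex: "\<exists>v\<in>?V. v \<bullet> b i \<noteq> 0" if "i \<in> I" for i
  proof -
    obtain y z where yz: "y \<in> span S" "\<And>w. w \<in> span S \<Longrightarrow> orthogonal z w" "b i = y + z"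
      using orthogonal_subspace_decomp_exists by blast
    have "z \<noteq> 0" using assms(2)[OF that] yz by auto
    moreover have "z \<bullet> y = 0" using yz by (simp add: orthogonal_def)
    ultimately have "z \<bullet> b i \<noteq> 0" using yz(3) by (simp add: inner_add_right)
    moreover have "z \<in> ?V" using yz(2) by (auto simp: orthogonal_def span_base)
    ultimately show ?thesis by blast
  qed
  have zero: "0 \<in> ?V" by simp
  obtain w where "w \<in> ?V" "\<And>i. i \<in> I \<Longrightarrow> w \<bullet> b i \<noteq> 0"
    using generic_perturbation[of I 0 ?V "\<lambda>u d v. u + d *\<^sub>R v" "\<lambda>i u. u \<bullet> b i", OF assms(1) zero _ _ ex]
    by (auto simp: inner_add_left)
  with that show ?thesis by blast
qed

text \<open>General position enters twice. Independence of \<open>T\<close> allows arbitrary signs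
  on \<open>T\<close>; independence of \<open>T\<close> with one further generator, which fits since
  \<open>card T < dim L\<close>, keeps that generator outside the span and so makes \<open>u\<close>
  nonzero off \<open>T\<close>. The signs of \<open>u\<close> off \<open>T\<close> form the base
  \<open>R\<close> of the subcube.\<close>

lemma half_patterns_strongly_shatters:
  fixes b :: "'i \<Rightarrow> 'a::euclidean_space"
  assumes "finite I" "e \<in> I" "T \<subseteq> I - {e}" and "card T < dim L"
    and gen: "general_linear_position b I L"
  shows "strongly_shatters (half_patterns b I e) T"
proof -
  have fT: "finite T" using assms(1,3) finite_subset by blast
  have ind: "inj_on b J \<and> independent (b ` J)" if "J \<subseteq> I" "card J \<le> dim L" for J
    using gen that assms(1) finite_subset unfolding general_linear_position_def by blast
  have indT: "inj_on b T" "independent (b ` T)" using ind[of T] assms(3,4) by auto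
  have "b i \<notin> span (b ` T)" if "i \<in> I - T" for i
  proof -
    have "inj_on b (insert i T)" "independent (b ` insert i T)"
      using ind[of "insert i T"] assms(3,4) that fT by auto
    moreover have "b i \<notin> b ` T" using calculation(1) that by (auto simp: inj_on_def)
    ultimately show ?thesis by (auto simp: independent_insert)
  qed
  then obtain u0 where u0: "\<And>x. x \<in> b ` T \<Longrightarrow> u0 \<bullet> x = 0" "\<And>i. i \<in> I - T \<Longrightarrow> u0 \<bullet> b i \<noteq> 0"
    using generic_orthogonal_vector[of "I - T" b "b ` T"] assms(1) by blast
  \<comment> \<open>The conditions on \<open>u0\<close> are invariant under negation, so its sign
    can be chosen to be positive at \<open>e\<close>.\<close>
  define u where "u = (if u0 \<bullet> b e > 0 then u0 else - u0)"
  have u: "u \<bullet> b i = 0" if "i \<in> T" for i using u0(1) that by (simp add: u_def)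
  have u': "u \<bullet> b i \<noteq> 0" if "i \<in> I - T" for i using u0(2) that by (simp add: u_def)
  have ue: "u \<bullet> b e > 0" using u0(2)[of e] assms(2,3) by (force simp: u_def not_less le_less)
  define R where "R = {i \<in> I - {e} - T. u \<bullet> b i > 0}"
  have "R \<union> A \<in> half_patterns b I e" if A: "A \<subseteq> T" for A
  proof -
    \<comment> \<open>Values are prescribed on vectors while \<open>A\<close> consists of indices;
      injectivity of \<open>b\<close> on \<open>T\<close> translates between them.\<close>
    obtain v where v: "\<forall>x\<in>b ` T. v \<bullet> x = (if the_inv_into T b x \<in> A then 1 else - 1)"
      using functional_prescribed_on_independent[OF indT(2),
        of "\<lambda>x. if the_inv_into T b x \<in> A then 1 else - 1"] by blast
    have vT: "v \<bullet> b i = (if i \<in> A then 1 else - 1)" if "i \<in> T" for i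
      using v that indT(1) by (simp add: the_inv_into_f_f)
    obtain d where d: "d > 0"
      "\<And>i. i \<in> I \<Longrightarrow> u \<bullet> b i \<noteq> 0 \<Longrightarrow> sgn (u \<bullet> b i + d * (v \<bullet> b i)) = sgn (u \<bullet> b i)"
      by (rule small_step_preserves_sgn[OF assms(1), of "\<lambda>i. u \<bullet> b i" "\<lambda>i. v \<bullet> b i"]) blast
    define w where "w = u + d *\<^sub>R v"
    have wT: "w \<bullet> b i = (if i \<in> A then d else - d)" if "i \<in> T" for i
      using vT[OF that] u[OF that] by (simp add: w_def inner_add_left)
    have wI: "sgn (w \<bullet> b i) = sgn (u \<bullet> b i)" if "i \<in> I - T" for i
      using d(2)[of i] u'[OF that] that by (simp add: w_def inner_add_left)
    have wpos: "w \<bullet> b i > 0 \<longleftrightarrow> u \<bullet> b i > 0" if "i \<in> I - T" for i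
      using wI[OF that] by (metis sgn_greater)
    have "w \<bullet> b i \<noteq> 0" if "i \<in> I" for i
      using wT[of i] wI[of i] u'[of i] that d(1) by (cases "i \<in> T") (auto simp: sgn_zero_iff split: if_splits)
    moreover have "w \<bullet> b e > 0" using wpos[of e] ue assms(2,3) by auto
    moreover have "R \<union> A = {i \<in> I - {e}. w \<bullet> b i > 0}"
    proof (rule set_eqI)
      fix i
      show "i \<in> R \<union> A \<longleftrightarrow> i \<in> {i \<in> I - {e}. w \<bullet> b i > 0}"
        using wT[of i] wpos[of i] A assms(3) d(1) by (cases "i \<in> T") (auto simp: R_def)
    qed
    ultimately show ?thesis unfolding half_patterns_def by blast
  qed
  moreover have "R \<inter> T = {}" by (auto simp: R_def)
  ultimately show ?thesis unfolding strongly_shatters_def by blast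
qed

lemma card_strict_patterns_le:
  fixes b :: "'i \<Rightarrow> 'a::euclidean_space"
  assumes "finite I" "e \<in> I" "dim (b ` I) = d" "d \<ge> 1"
  shows "card (strict_patterns b I) \<le> 2 * (\<Sum>j=0..d-1. (card I - 1) choose j)"
proof -
  let ?X = "I - {e}" and ?H = "half_patterns b I e"
  have "?H \<subseteq> Pow ?X" by (auto simp: half_patterns_def)
  then have "card ?H \<le> card {T. T \<subseteq> ?X \<and> shatters ?H T}"
    using shattering_sandwich[of ?X ?H] assms(1) by blast
  also have "\<dots> \<le> card {T. T \<subseteq> ?X \<and> card T \<le> d - 1}"
  proof (intro card_mono subsetI)
    fix T assume "T \<in> {T. T \<subseteq> ?X \<and> shatters ?H T}"
    then show "T \<in> {T. T \<subseteq> ?X \<and> card T \<le> d - 1}"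
      using half_patterns_shatters_card[OF assms(1,2), of T b] assms(3) by auto
  qed (use assms(1) in simp)
  finally show ?thesis
    using assms(1,2) by (simp add: card_strict_patterns card_subsets_card_le)
qed

lemma card_strict_patterns_eq:
  fixes b :: "'i \<Rightarrow> 'a::euclidean_space"
  assumes "finite I" "e \<in> I" "dim (b ` I) = d" "d \<ge> 1"
    and "general_linear_position b I L" "dim L = d"
  shows "card (strict_patterns b I) = 2 * (\<Sum>j=0..d-1. (card I - 1) choose j)"
proof (rule antisym)
  let ?X = "I - {e}" and ?H = "half_patterns b I e"
  have "card {T. T \<subseteq> ?X \<and> card T \<le> d - 1} \<le> card {T. T \<subseteq> ?X \<and> strongly_shatters ?H T}"
    using half_patterns_strongly_shatters[OF assms(1,2) _ _ assms(5)] assms(1,4,6)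
    by (intro card_mono) auto
  also have "?H \<subseteq> Pow ?X" by (auto simp: half_patterns_def)
  then have "card {T. T \<subseteq> ?X \<and> strongly_shatters ?H T} \<le> card ?H"
    using shattering_sandwich[of ?X ?H] assms(1) by blast
  finally show "2 * (\<Sum>j=0..d-1. (card I - 1) choose j) \<le> card (strict_patterns b I)"
    using assms(1,2) by (simp add: card_strict_patterns card_subsets_card_le)
qed (rule card_strict_patterns_le[OF assms(1-4)])

section \<open>Vertices of a zonotope\<close>

lemma zonotope_eq: "zonotope B = {\<Sum>i\<in>UNIV. t i *\<^sub>R row i B |t. \<forall>i. t i \<in> {-1..1::real}}"
proof -
  have mult: "transpose B *v t = (\<Sum>i\<in>UNIV. t $ i *\<^sub>R row i B)" for t
    by (simp add: vec_eq_iff matrix_vector_mult_def transpose_def row_def mult.commute)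
  show ?thesis
  proof (intro equalityI subsetI)
    fix x assume "x \<in> zonotope B"
    then show "x \<in> {\<Sum>i\<in>UNIV. t i *\<^sub>R row i B |t. \<forall>i. t i \<in> {-1..1::real}}"
      unfolding zonotope_def mult by blast
  next
    fix x assume "x \<in> {\<Sum>i\<in>UNIV. t i *\<^sub>R row i B |t. \<forall>i. t i \<in> {-1..1::real}}"
    then obtain t where "x = (\<Sum>i\<in>UNIV. t i *\<^sub>R row i B)" "\<forall>i. t i \<in> {-1..1::real}" by blast
    then show "x \<in> zonotope B"
      unfolding zonotope_def mult by (intro image_eqI[of _ _ "\<chi> i. t i"]) auto
  qed
qed

lemma zonotope_sum_mem:
  "(\<And>i. t i \<in> {-1..1::real}) \<Longrightarrow> (\<Sum>i\<in>UNIV. t i *\<^sub>R row i B) \<in> zonotope B"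
  unfolding zonotope_eq by blast

lemma closed_segment_symmetric:
  "closed_segment (- x) x = {t *\<^sub>R x |t. t \<in> {-1..1::real}}" for x :: "'a::real_vector"
proof (intro equalityI subsetI)
  fix y assume "y \<in> closed_segment (- x) x"
  then obtain u where u: "0 \<le> u" "u \<le> 1" "y = (1 - u) *\<^sub>R (- x) + u *\<^sub>R x"
    by (auto simp: in_segment)
  then have "y = (2 * u - 1) *\<^sub>R x" by (simp add: algebra_simps flip: scaleR_add_left)
  with u(1,2) show "y \<in> {t *\<^sub>R x |t. t \<in> {-1..1}}" by force
next
  fix y assume "y \<in> {t *\<^sub>R x |t. t \<in> {-1..1::real}}"
  then obtain t where t: "t \<in> {-1..1}" "y = t *\<^sub>R x" by blast
  have "y = (1 - (1 + t) / 2) *\<^sub>R (- x) + ((1 + t) / 2) *\<^sub>R x"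
    by (simp add: t(2) scaleR_minus_right flip: scaleR_minus_left scaleR_add_left)
      (simp add: field_simps)
  moreover have "0 \<le> (1 + t) / 2" "(1 + t) / 2 \<le> 1" using t(1) by auto
  ultimately show "y \<in> closed_segment (- x) x" unfolding in_segment by blast
qed

lemma zonotope_eq_sum_segments:
  fixes B :: "real^'r^'n"
  shows "zonotope B = (\<Sum>i\<in>UNIV. closed_segment (- row i B) (row i B))"
proof -
  have "(\<Sum>i\<in>UNIV. closed_segment (- row i B) (row i B)) =
      {sum s UNIV |s. \<forall>i\<in>UNIV. s i \<in> closed_segment (- row i B) (row i B)}"
    by (rule set_sum_alt) simp
  also have "\<dots> = {\<Sum>i\<in>UNIV. t i *\<^sub>R row i B |t. \<forall>i. t i \<in> {-1..1::real}}"
  proof (intro equalityI subsetI)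
    fix x assume "x \<in> {sum s UNIV |s. \<forall>i\<in>UNIV. s i \<in> closed_segment (- row i B) (row i B)}"
    then obtain s where s: "x = sum s UNIV" "\<forall>i. s i \<in> closed_segment (- row i B) (row i B)"
      by blast
    then have "\<forall>i. \<exists>t. t \<in> {-1..1::real} \<and> s i = t *\<^sub>R row i B"
      unfolding closed_segment_symmetric by blast
    then obtain t where "\<forall>i. t i \<in> {-1..1::real} \<and> s i = t i *\<^sub>R row i B"
      by metis
    with s(1) show "x \<in> {\<Sum>i\<in>UNIV. t i *\<^sub>R row i B |t. \<forall>i. t i \<in> {-1..1::real}}"
      by auto
  qed (auto simp: closed_segment_symmetric)
  finally show ?thesis by (simp only: zonotope_eq)
qed

lemma polytope_zonotope:
  fixes B :: "real^'r^'n"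
  shows "polytope (zonotope B)"
proof -
  have "{t :: real^'n. \<forall>i. t $ i \<in> {-1..1}} = cbox (- 1) 1"
    by (auto simp: mem_box_cart)
  then show ?thesis
    unfolding zonotope_def
    by (simp only: polytope_interval polytope_linear_image matrix_vector_mul_linear)
qed

lemma span_zonotope: "span (zonotope B) = span ((\<lambda>i. row i B) ` {i. row i B \<noteq> 0})"
proof -
  have "row i B \<in> zonotope B" for i
    using zonotope_sum_mem[of "\<lambda>k. if k = i then 1 else 0" B]
    by (simp add: if_distrib[where f = "\<lambda>c. c *\<^sub>R _"] cong: if_cong)
  moreover have "row i B \<in> span ((\<lambda>i. row i B) ` {i. row i B \<noteq> 0})" for i
    by (cases "row i B = 0") (auto simp: span_zero intro: span_base)
  then have "zonotope B \<subseteq> span ((\<lambda>i. row i B) ` {i. row i B \<noteq> 0})"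
    by (auto simp: zonotope_eq intro!: span_sum span_scale)
  ultimately show ?thesis
    by (intro span_eq[THEN iffD2]) (auto intro: span_base)
qed

lemma zero_mem_zonotope: "0 \<in> zonotope B"
  using zonotope_sum_mem[of "\<lambda>_. 0" B] by simp

text \<open>The zonotope contains 0, so its affine hull is its linear span; hence d is the rank of
  the nonzero rows, the dimension that the pattern counts refer to.\<close>

lemma aff_dim_zonotope:
  "aff_dim (zonotope B) = int (dim ((\<lambda>i. row i B) ` {i. row i B \<noteq> 0}))"
proof -
  have "aff_dim (zonotope B) = int (dim (zonotope B))"
    by (rule aff_dim_zero) (simp add: zero_mem_zonotope hull_inc)
  also have "dim (zonotope B) = dim (span (zonotope B))" by simp
  finally show ?thesis by (simp only: span_zonotope dim_span)
qed

text \<open>Identifies the space \<open>L\<close> of the general position hypothesis with the span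
  of the zonotope.\<close>

lemma span_differences:
  assumes "0 \<in> S"
  shows "span {x - y |x y. x \<in> S \<and> y \<in> S} = span S"
proof -
  have "x \<in> {x - y |x y. x \<in> S \<and> y \<in> S}" if "x \<in> S" for x
    using that assms by (intro CollectI exI[of _ x] exI[of _ 0]) simp
  then show ?thesis
    by (intro span_eq[THEN iffD2]) (auto intro: span_base span_diff)
qed

section \<open>Supporting functionals and vertices\<close>

definition signed_sum :: "real^'r^'n \<Rightarrow> 'n set \<Rightarrow> real^'r" where
  "signed_sum B A = (\<Sum>i\<in>UNIV. (if i \<in> A then 1 else - 1) *\<^sub>R row i B)"

lemma signed_sum_mem: "signed_sum B A \<in> zonotope B"
  unfolding signed_sum_def by (rule zonotope_sum_mem) simp

text \<open>A linear functional is maximized coefficient by coefficient. Every nonzero row has a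
  nonzero value under \<open>u\<close>, so any deviation of its coefficient from the optimal sign
  strictly lowers the value; the second part, uniqueness of the coefficients, is the source of both
  extremality and injectivity.\<close>

lemma inner_zonotope_le:
  fixes B :: "real^'r^'n" and u :: "real^'r"
  assumes u: "\<And>i. row i B \<noteq> 0 \<Longrightarrow> u \<bullet> row i B \<noteq> 0" and t: "\<And>i. t i \<in> {-1..1::real}"
    and A: "A = {i. row i B \<noteq> 0 \<and> u \<bullet> row i B > 0}"
  shows "u \<bullet> (\<Sum>i\<in>UNIV. t i *\<^sub>R row i B) \<le> u \<bullet> signed_sum B A"
    and "u \<bullet> (\<Sum>i\<in>UNIV. t i *\<^sub>R row i B) = u \<bullet> signed_sum B A \<Longrightarrow> row i B \<noteq> 0 \<Longrightarrow>
      t i = (if i \<in> A then 1 else - 1)"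
proof -
  let ?s = "\<lambda>i. if i \<in> A then 1 else - 1 :: real"
  have diff: "u \<bullet> signed_sum B A - u \<bullet> (\<Sum>i\<in>UNIV. t i *\<^sub>R row i B) =
      (\<Sum>i\<in>UNIV. (?s i - t i) * (u \<bullet> row i B))"
    by (simp only: signed_sum_def inner_sum_right inner_scaleR_right left_diff_distrib sum_subtractf)
  have nn: "(?s i - t i) * (u \<bullet> row i B) \<ge> 0" for i
  proof (cases "row i B = 0")
    case False
    show ?thesis
    proof (cases "i \<in> A")
      case True
      with A t[of i] show ?thesis by auto
    next
      case False
      with A \<open>row i B \<noteq> 0\<close> have "u \<bullet> row i B \<le> 0" by auto
      with False t[of i] show ?thesis by (auto intro!: mult_nonpos_nonpos)
    qed
  qed simp
  show "u \<bullet> (\<Sum>i\<in>UNIV. t i *\<^sub>R row i B) \<le> u \<bullet> signed_sum B A"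
    using diff sum_nonneg[of UNIV "\<lambda>i. (?s i - t i) * (u \<bullet> row i B)"] nn by simp
  assume eq: "u \<bullet> (\<Sum>i\<in>UNIV. t i *\<^sub>R row i B) = u \<bullet> signed_sum B A" and "row i B \<noteq> 0"
  with diff have "(\<Sum>i\<in>UNIV. (?s i - t i) * (u \<bullet> row i B)) = 0" by simp
  then have "\<forall>i\<in>UNIV. (?s i - t i) * (u \<bullet> row i B) = 0"
    using nn by (subst (asm) sum_nonneg_eq_0_iff) auto
  then have "(?s i - t i) * (u \<bullet> row i B) = 0" by blast
  with u[OF \<open>row i B \<noteq> 0\<close>] show "t i = ?s i" by simp
qed

lemma sum_rows_cong:
  fixes B :: "real^'r^'n"
  assumes "\<And>i. row i B \<noteq> 0 \<Longrightarrow> t i = s i"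
  shows "(\<Sum>i\<in>UNIV. t i *\<^sub>R row i B) = (\<Sum>i\<in>UNIV. s i *\<^sub>R row i B)"
proof (rule sum.cong)
  show "t i *\<^sub>R row i B = s i *\<^sub>R row i B" for i
    using assms[of i] by (cases "row i B = 0") auto
qed simp

text \<open>A generic \<open>u\<close> exposes a single point. Conversely, extreme points of a
  polytope are exposed, and the exposing functional must be generic: at a nonzero row orthogonal to
  \<open>u\<close> the coefficient could be changed without leaving the face.\<close>

lemma bij_betw_strict_patterns_vert:
  fixes B :: "real^'r^'n"
  shows "bij_betw (signed_sum B) (strict_patterns (\<lambda>i. row i B) {i. row i B \<noteq> 0}) (vert (zonotope B))"
    (is "bij_betw _ ?P _")
proof -
  have P: "\<exists>u. (\<forall>i. row i B \<noteq> 0 \<longrightarrow> u \<bullet> row i B \<noteq> 0) \<and> A = {i. row i B \<noteq> 0 \<and> u \<bullet> row i B > 0}"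
    if "A \<in> ?P" for A using that by (auto simp: strict_patterns_def)
  have "inj_on (signed_sum B) ?P"
  proof (rule inj_onI)
    fix A A' assume A: "A \<in> ?P" and A': "A' \<in> ?P" and eq: "signed_sum B A = signed_sum B A'"
    from P[OF A] obtain u where u: "\<forall>i. row i B \<noteq> 0 \<longrightarrow> u \<bullet> row i B \<noteq> 0"
      "A = {i. row i B \<noteq> 0 \<and> u \<bullet> row i B > 0}" by blast
    have "(if i \<in> A' then 1 else - 1) = (if i \<in> A then 1 else - 1 :: real)" if "row i B \<noteq> 0" for i
      by (rule inner_zonotope_le(2)[OF _ _ u(2) _ that])
        (use u(1) eq in \<open>auto simp: signed_sum_def\<close>)
    then have "i \<in> A \<longleftrightarrow> i \<in> A'" if "row i B \<noteq> 0" for i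
      using that by (metis one_neq_neg_one)
    with P[OF A] P[OF A'] show "A = A'" by blast
  qed
  moreover have "signed_sum B ` ?P = vert (zonotope B)"
  proof (intro equalityI subsetI)
    fix v assume "v \<in> signed_sum B ` ?P"
    then obtain A where A: "A \<in> ?P" and v: "v = signed_sum B A" by blast
    from P[OF A] obtain u where u: "\<And>i. row i B \<noteq> 0 \<Longrightarrow> u \<bullet> row i B \<noteq> 0"
      "A = {i. row i B \<noteq> 0 \<and> u \<bullet> row i B > 0}" by blast
    have le: "u \<bullet> x \<le> u \<bullet> v" if "x \<in> zonotope B" for x
      using that inner_zonotope_le(1)[OF u(1) _ u(2)] by (auto simp: zonotope_eq v)
    have "x = v" if x: "x \<in> zonotope B" "u \<bullet> x = u \<bullet> v" for x
    proof -
      from x(1) obtain t where t: "x = (\<Sum>i\<in>UNIV. t i *\<^sub>R row i B)" "\<And>i. t i \<in> {-1..1::real}"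
        unfolding zonotope_eq by blast
      have "t i = (if i \<in> A then 1 else - 1)" if "row i B \<noteq> 0" for i
        by (rule inner_zonotope_le(2)[OF u(1) t(2) u(2) _ that]) (use x(2) t(1) v in auto)
      then show ?thesis unfolding t(1) v signed_sum_def by (rule sum_rows_cong)
    qed
    then have "zonotope B \<inter> {x. u \<bullet> x = u \<bullet> v} = {v}"
      using signed_sum_mem[of B A] v by auto
    moreover have "zonotope B \<inter> {x. u \<bullet> x = u \<bullet> v} face_of zonotope B"
      using polytope_imp_convex[OF polytope_zonotope] le
      by (rule face_of_Int_supporting_hyperplane_le)
    ultimately show "v \<in> vert (zonotope B)" by (simp add: vert_def face_of_singleton)
  next
    fix v assume "v \<in> vert (zonotope B)"
    then have "{v} exposed_face_of zonotope B"
      by (simp add: vert_def face_of_singleton exposed_face_of_polyhedron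
          polytope_imp_polyhedron polytope_zonotope)
    then obtain u c where le: "zonotope B \<subseteq> {x. u \<bullet> x \<le> c}"
      and v: "{v} = zonotope B \<inter> {x. u \<bullet> x = c}"
      unfolding exposed_face_of_def by blast
    from v have "v \<in> zonotope B" "u \<bullet> v = c" by auto
    then obtain t where t: "v = (\<Sum>i\<in>UNIV. t i *\<^sub>R row i B)" "\<And>i. t i \<in> {-1..1::real}"
      unfolding zonotope_eq by blast
    have u: "u \<bullet> row i B \<noteq> 0" if "row i B \<noteq> 0" for i
    proof
      assume 0: "u \<bullet> row i B = 0"
      \<comment> \<open>Any admissible coefficient different from \<open>t i\<close> gives a second
        point of the same face.\<close>
      define a where "a = (if t i = 1 then - 1 else 1 :: real)"
      let ?x = "\<Sum>k\<in>UNIV. (t(i := a)) k *\<^sub>R row k B"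
      have "?x - v = (\<Sum>k\<in>UNIV. ((t(i := a)) k - t k) *\<^sub>R row k B)"
        unfolding t(1) by (simp only: scaleR_left_diff_distrib sum_subtractf)
      also have "\<dots> = (\<Sum>k\<in>UNIV. if k = i then (a - t i) *\<^sub>R row i B else 0)"
        by (rule sum.cong) auto
      also have "\<dots> = (a - t i) *\<^sub>R row i B" by simp
      finally have d: "?x - v = (a - t i) *\<^sub>R row i B" .
      have "?x \<in> zonotope B" using t(2) by (intro zonotope_sum_mem) (auto simp: a_def)
      moreover have "u \<bullet> ?x = c"
        using arg_cong[OF d, of "\<lambda>x. u \<bullet> x"] 0 \<open>u \<bullet> v = c\<close> by (simp add: inner_diff_right)
      ultimately have "?x = v" using v by blast
      with d that have "a = t i" by simp
      then show False by (auto simp: a_def split: if_splits)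
    qed
    define A where "A = {i. row i B \<noteq> 0 \<and> u \<bullet> row i B > 0}"
    have "u \<bullet> v \<le> u \<bullet> signed_sum B A"
      unfolding t(1) by (rule inner_zonotope_le(1)[OF u t(2) A_def])
    with le signed_sum_mem[of B A] \<open>u \<bullet> v = c\<close> have "u \<bullet> signed_sum B A = c" by auto
    with v signed_sum_mem[of B A] have "signed_sum B A = v" by blast
    moreover have "A \<in> ?P" using u by (auto simp: strict_patterns_def A_def)
    ultimately show "v \<in> signed_sum B ` ?P" by blast
  qed
  ultimately show ?thesis by (simp add: bij_betw_def)
qed

section \<open>Growth rate and the assembled vertex bounds\<close>

text \<open>For \<open>N \<ge> 1\<close> each of the \<open>d\<close> binomials is at most
  \<open>N ^ (d - 1)\<close>, whence the constant \<open>2 * d\<close>.\<close>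

lemma sum_binomial_bigo:
  assumes "d \<ge> 1"
  shows "(\<lambda>N. real (2 * (\<Sum>j=0..d-1. (N - 1) choose j))) \<in> O(\<lambda>N. real N ^ (d - 1))"
proof (rule bigoI)
  show "\<forall>\<^sub>F N in at_top. norm (real (2 * (\<Sum>j=0..d-1. (N - 1) choose j)))
      \<le> real (2 * d) * norm (real N ^ (d - 1))"
    using eventually_ge_at_top[of 1]
  proof eventually_elim
    fix N :: nat assume N: "1 \<le> N"
    have "(N - 1) choose j \<le> N ^ (d - 1)" if "j \<in> {0..d-1}" for j
    proof -
      have "(N - 1) choose j \<le> N choose j" by (simp add: binomial_right_mono)
      also have "\<dots> \<le> N ^ j"
        by (cases "j \<le> N") (auto simp: binomial_le_pow binomial_eq_0)
      also have "\<dots> \<le> N ^ (d - 1)" using N that by (intro power_increasing) auto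
      finally show ?thesis .
    qed
    then have "(\<Sum>j\<in>{0..d-1}. (N - 1) choose j) \<le> of_nat (card {0..d-1}) * N ^ (d - 1)"
      by (rule sum_bounded_above)
    then have "(\<Sum>j=0..d-1. (N - 1) choose j) \<le> d * N ^ (d - 1)"
      using assms by simp
    then have "2 * (\<Sum>j=0..d-1. (N - 1) choose j) \<le> 2 * d * N ^ (d - 1)" by simp
    then have "real (2 * (\<Sum>j=0..d-1. (N - 1) choose j)) \<le> real (2 * d * N ^ (d - 1))"
      by (simp only: of_nat_le_iff)
    then show "norm (real (2 * (\<Sum>j=0..d-1. (N - 1) choose j))) \<le> real (2 * d) * norm (real N ^ (d - 1))"
      by (simp only: real_norm_def abs_of_nat flip: of_nat_power of_nat_mult)
  qed
qed

lemma zonotope_vertices: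
  fixes B :: "real^'r^'n" and n m d :: nat
  assumes "n = CARD('n)"
    and "m = card {i. row i B \<noteq> 0}"
    and "int d = aff_dim (zonotope B)"
    and "d \<ge> 1"
  shows "finite (vert (zonotope B))"
    and "card (vert (zonotope B)) \<le> 2 * (\<Sum>j=0..d-1. (m - 1) choose j)"
    and "2 * (\<Sum>j=0..d-1. (m - 1) choose j) \<le> 2 * (\<Sum>j=0..d-1. (n - 1) choose j)"
    and "general_linear_position (\<lambda>i. row i B) {i. row i B \<noteq> 0}
          (span {x - y | x y. x \<in> zonotope B \<and> y \<in> zonotope B}) \<Longrightarrow>
        card (vert (zonotope B)) = 2 * (\<Sum>j=0..d-1. (m - 1) choose j)"
proof -
  let ?b = "\<lambda>i. row i B" and ?I = "{i. row i B \<noteq> 0}"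
  have dim: "dim (?b ` ?I) = d" using assms(3) aff_dim_zonotope[of B] by simp
  \<comment> \<open>Positive dimension forces a nonzero row, which serves as the distinguished index
    \<open>e\<close>.\<close>
  have "?I \<noteq> {}" using dim assms(4) by (intro notI) simp
  then obtain e where e: "e \<in> ?I" by blast
  note bij = bij_betw_strict_patterns_vert[of B]
  show "finite (vert (zonotope B))"
    using bij_betw_finite[OF bij] finite_subset[of "strict_patterns ?b ?I" UNIV] by simp
  have card: "card (vert (zonotope B)) = card (strict_patterns ?b ?I)"
    using bij_betw_same_card[OF bij] by simp
  show "card (vert (zonotope B)) \<le> 2 * (\<Sum>j=0..d-1. (m - 1) choose j)"
    unfolding card assms(2) by (rule card_strict_patterns_le[OF _ e dim assms(4)]) simp
  have "m \<le> n" unfolding assms(1,2) by (rule card_mono) auto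
  then show "2 * (\<Sum>j=0..d-1. (m - 1) choose j) \<le> 2 * (\<Sum>j=0..d-1. (n - 1) choose j)"
    by (intro mult_le_mono2 sum_mono binomial_right_mono) simp
  assume gen: "general_linear_position ?b ?I (span {x - y | x y. x \<in> zonotope B \<and> y \<in> zonotope B})"
  show "card (vert (zonotope B)) = 2 * (\<Sum>j=0..d-1. (m - 1) choose j)"
    unfolding card assms(2)
    by (rule card_strict_patterns_eq[OF _ e dim assms(4) gen])
      (simp_all add: span_differences zero_mem_zonotope span_zonotope dim)
qed

lemma zonotope_point:
  assumes "aff_dim (zonotope B) = 0"
  shows "is_singleton (zonotope B) \<and> card (vert (zonotope B)) = 1"
proof -
  from assms obtain a where "zonotope B = {a}" using aff_dim_eq_0 by blast
  then show ?thesis by (simp add: vert_def)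
qed

section \<open>Enumerating sign patterns by elimination\<close>

text \<open>
  The new signs override the old ones as long as a row has a nonzero quotient; a row that has
  become zero keeps its sign. If the pivot entry is zero, then so are all quotients
  (\<open>x / 0 = 0\<close>), and nothing changes.
\<close>

definition eliminated ::
  "nat \<Rightarrow> nat \<Rightarrow> nat \<Rightarrow> nat \<Rightarrow> real \<Rightarrow> (nat \<Rightarrow> nat \<Rightarrow> real) \<Rightarrow> (nat \<Rightarrow> real) \<Rightarrow>
    (nat \<Rightarrow> nat \<Rightarrow> real) \<Rightarrow> (nat \<Rightarrow> real) \<Rightarrow> bool" where
  "eliminated r n k p \<delta> C X C' X' \<longleftrightarrow>
     (\<forall>i<n. (\<forall>j<r. C' i j = C i j - C i k / C p k * C p j) \<and>
       X' i = (if C i k / C p k > 0 then \<delta> else if C i k / C p k < 0 then - \<delta> else X i))"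

text \<open>
  Only the entries with \<open>i < n\<close> and \<open>j < r\<close> of the next level are determined, hence the universal
  quantifier over \<open>C'\<close> and \<open>X'\<close>.
\<close>

primrec reachable ::
  "nat \<Rightarrow> nat \<Rightarrow> nat \<Rightarrow> nat \<Rightarrow> (nat \<Rightarrow> nat \<Rightarrow> real) \<Rightarrow> (nat \<Rightarrow> real) \<Rightarrow> (nat \<Rightarrow> real) \<Rightarrow> bool"
where
  "reachable r n 0 k C X \<sigma> \<longleftrightarrow> (\<forall>i<n. \<sigma> i = X i)"
| "reachable r n (Suc m) k C X \<sigma> \<longleftrightarrow>
     (\<exists>p<n. \<exists>\<delta>\<in>{1, -1}. \<forall>C' X'. eliminated r n k p \<delta> C X C' X' \<longrightarrow>
        reachable r n m (Suc k) C' X' \<sigma>)"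

text \<open>
  The line through \<open>u\<close> in the direction of coordinate \<open>k\<close> is followed to the first
  hyperplane it meets, that of row \<open>p\<close>. On that hyperplane the eliminated rows realize the
  same signs, except that rows proportional to row \<open>p\<close> vanish there and have to be
  assigned their sign when they do.
\<close>

lemma strict_pattern_reachable:
  assumes "r = k + m" "n > 0"
    and "\<And>i. i < n \<Longrightarrow> (\<forall>j\<in>{k..<r}. C i j = 0) \<and> \<sigma> i = X i \<or>
      (\<Sum>j=k..<r. C i j * u j) \<noteq> 0 \<and> \<sigma> i = sgn (\<Sum>j=k..<r. C i j * u j)"
  shows "reachable r n m k C X \<sigma>"
  using assms
\<comment> \<open>Invariant: a row that is zero in the remaining columns already has its final sign
  in \<open>X\<close>; the others are still decided by \<open>u\<close>.\<close>
proof (induction m arbitrary: k C X u)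
  \<comment> \<open>No column remains, so every sum is empty and the second alternative is
    impossible: all signs are stored.\<close>
  case 0
  then show ?case by fastforce
next
  case (Suc m)
  have kr: "k < r" "r = Suc k + m" using Suc.prems(1) by auto
  have split: "(\<Sum>j=k..<r. w j * v j) = w k * v k + (\<Sum>j=Suc k..<r. w j * v j)"
    for w v :: "nat \<Rightarrow> real"
    using kr(1) by (rule sum.atLeast_Suc_lessThan)
  show ?case
  proof (cases "\<forall>i<n. C i k = 0")
    case True
    \<comment> \<open>In a zero column all quotients are 0 and elimination changes nothing;
      \<open>n > 0\<close> provides row 0 as a dummy pivot.\<close>
    have "reachable r n m (Suc k) C' X' \<sigma>" if el: "eliminated r n k 0 1 C X C' X'" for C' X'
    proof (rule Suc.IH[OF kr(2) Suc.prems(2)])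
      fix i assume i: "i < n"
      have eq: "C' i j = C i j" if "j < r" for j
        using el i that True by (auto simp: eliminated_def)
      have X: "X' i = X i" using el i True by (auto simp: eliminated_def)
      have s: "(\<Sum>j=Suc k..<r. C' i j * u j) = (\<Sum>j=k..<r. C i j * u j)"
        unfolding split using True i by (auto intro!: sum.cong simp: eq)
      show "(\<forall>j\<in>{Suc k..<r}. C' i j = 0) \<and> \<sigma> i = X' i \<or>
        (\<Sum>j=Suc k..<r. C' i j * u j) \<noteq> 0 \<and> \<sigma> i = sgn (\<Sum>j=Suc k..<r. C' i j * u j)"
        using Suc.prems(3)[OF i] unfolding s by (auto simp: X eq)
    qed
    then show ?thesis using Suc.prems(2) by auto
  next
    case False
    define dot where "dot w v = (\<Sum>j=k..<r. w j * v j)" for w v :: "nat \<Rightarrow> real"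
    define cross where "cross i p = (\<lambda>j. C p k * C i j - C i k * C p j)" for i p
    \<comment> \<open>\<open>cross i p\<close> is elimination without division. Genericity on these
      combinations means that rows \<open>i\<close> and \<open>p\<close> can vanish simultaneously
      on the line only if they are proportional. Functionals that are identically zero are excluded,
      as no \<open>v\<close> is nonzero on them.\<close>
    define W where "W = {w \<in> C ` {..<n} \<union> (\<lambda>(i, p). cross i p) ` ({..<n} \<times> {..<n}).
      \<exists>j\<in>{k..<r}. w j \<noteq> 0}"
    have "finite W" by (simp add: W_def)
    have nz: "\<exists>v\<in>UNIV. dot w v \<noteq> 0" if "w \<in> W" for w
    proof -
      from that obtain j where j: "j \<in> {k..<r}" "w j \<noteq> 0" by (auto simp: W_def)
      have "dot w (\<lambda>l. if l = j then 1 else 0) = (\<Sum>l=k..<r. if l = j then w j else 0)"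
        unfolding dot_def by (rule sum.cong) auto
      also have "\<dots> = w j" using j(1) by simp
      finally show ?thesis using j(2) by (intro bexI[of _ "\<lambda>l. if l = j then 1 else 0"]) simp_all
    qed
    have lin: "dot w (\<lambda>j. x j + d * y j) = dot w x + d * dot w y" for w x d y
      by (simp add: dot_def sum.distrib sum_distrib_left algebra_simps)
    obtain v where v: "\<And>w. w \<in> W \<Longrightarrow> dot w v \<noteq> 0"
      "\<And>w. w \<in> W \<Longrightarrow> dot w u \<noteq> 0 \<Longrightarrow> sgn (dot w v) = sgn (dot w u)"
      using generic_perturbation[of W u UNIV "\<lambda>x d y j. x j + d * y j" dot,
            OF \<open>finite W\<close> UNIV_I UNIV_I lin nz] by blast
    have hyp: "(\<forall>j\<in>{k..<r}. C i j = 0) \<and> \<sigma> i = X i \<or>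
        dot (C i) v \<noteq> 0 \<and> \<sigma> i = sgn (dot (C i) v)" if i: "i < n" for i
    proof (cases "\<forall>j\<in>{k..<r}. C i j = 0")
      case True
      then have "dot (C i) u = 0" by (simp add: dot_def)
      with Suc.prems(3)[OF i] True show ?thesis by (simp add: dot_def)
    next
      case False
      then have "C i \<in> W" using i by (auto simp: W_def)
      with v[of "C i"] Suc.prems(3)[OF i] False show ?thesis by (auto simp: dot_def)
    qed
    \<comment> \<open>Lowering coordinate \<open>k\<close> of \<open>v\<close> by \<open>t i\<close>
      makes row \<open>i\<close> vanish. The smallest absolute value belongs to the first hyperplane
      met in either direction; the later coordinates of \<open>v\<close> stay as they are.\<close>
    define t where "t i = dot (C i) v / C i k" for i
    let ?K = "{i. i < n \<and> C i k \<noteq> 0}"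
    have "finite ?K" "?K \<noteq> {}" using False by auto
    then obtain p where p: "p \<in> ?K" "\<And>i. i \<in> ?K \<Longrightarrow> \<bar>t p\<bar> \<le> \<bar>t i\<bar>"
      using arg_min_if_finite[of ?K "\<lambda>i. \<bar>t i\<bar>"] by (metis (no_types, lifting) not_le)
    have Cpk: "C p k \<noteq> 0" "p < n" using p(1) by auto
    have dp: "dot (C p) v \<noteq> 0" using hyp[OF Cpk(2)] Cpk(1) kr(1) by force
    define \<delta> where "\<delta> = sgn (dot (C p) v)"
    have \<delta>: "\<delta> \<in> {1, -1}" using dp by (auto simp: \<delta>_def sgn_if)
    have "reachable r n m (Suc k) C' X' \<sigma>" if el: "eliminated r n k p \<delta> C X C' X'" for C' X'
    proof (rule Suc.IH[OF kr(2) Suc.prems(2)])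
      fix i assume i: "i < n"
      have C': "C' i j = C i j - C i k / C p k * C p j" if "j < r" for j
        using el i that by (auto simp: eliminated_def)
      have X': "X' i = (if C i k / C p k > 0 then \<delta> else if C i k / C p k < 0 then - \<delta> else X i)"
        using el i by (auto simp: eliminated_def)
      have "(\<Sum>j=Suc k..<r. C' i j * v j) =
          (\<Sum>j=Suc k..<r. C i j * v j - C i k / C p k * (C p j * v j))"
        by (rule sum.cong) (auto simp: C' algebra_simps)
      also have "\<dots> = (\<Sum>j=Suc k..<r. C i j * v j) - C i k / C p k * (\<Sum>j=Suc k..<r. C p j * v j)"
        by (simp only: sum_subtractf sum_distrib_left)
      also have "\<dots> = (dot (C i) v - C i k * v k) - C i k / C p k * (dot (C p) v - C p k * v k)"
        by (simp add: dot_def split)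
      also have "\<dots> = dot (C i) v - C i k * t p"
        using Cpk by (simp add: t_def field_simps)
      finally have s: "(\<Sum>j=Suc k..<r. C' i j * v j) = dot (C i) v - C i k * t p" .
      show "(\<forall>j\<in>{Suc k..<r}. C' i j = 0) \<and> \<sigma> i = X' i \<or>
        (\<Sum>j=Suc k..<r. C' i j * v j) \<noteq> 0 \<and> \<sigma> i = sgn (\<Sum>j=Suc k..<r. C' i j * v j)"
      proof (cases "C i k = 0")
        case True
        then show ?thesis using hyp[OF i] unfolding s by (auto simp: C' X')
      next
        case False
        have \<sigma>: "\<sigma> i = sgn (dot (C i) v)" "dot (C i) v \<noteq> 0"
          using hyp[OF i] False kr(1) by force+
        have d: "dot (C i) v = C i k * t i" using False by (simp add: t_def)
        have tp: "dot (C p) v = C p k * t p" using Cpk by (simp add: t_def)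
        show ?thesis
        proof (cases "\<forall>j\<in>{Suc k..<r}. C' i j = 0")
          case True
          then have "(\<Sum>j=Suc k..<r. C' i j * v j) = 0" by simp
          \<comment> \<open>Row \<open>i\<close> is proportional to the pivot row: it vanishes
            together with it, and its sign is \<open>\<delta>\<close> times the sign of the
            quotient.\<close>
          then have "t i = t p" using s d False by simp
          then have "\<sigma> i = sgn (C i k) * sgn (t p)" using \<sigma> d by (simp add: sgn_mult)
          also have "\<dots> = \<delta> * sgn (C i k / C p k)"
            using Cpk by (simp add: \<delta>_def tp sgn_mult sgn_divide sgn_zero_iff)
          also have "\<dots> = X' i"
          proof -
            have "C i k / C p k \<noteq> 0" using False Cpk by simp
            then show ?thesis unfolding X' sgn_if by simp
          qed
          finally show ?thesis using True by blast
        next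
          case nzr: False
          have "dot (cross i p) v = C p k * dot (C i) v - C i k * dot (C p) v"
            unfolding cross_def dot_def
            by (simp add: sum_subtractf sum_distrib_left algebra_simps)
          then have "dot (cross i p) v = C p k * (dot (C i) v - C i k * t p)"
            by (simp add: tp algebra_simps)
          moreover have "cross i p j = C p k * C' i j" if "j < r" for j
            using Cpk that by (simp add: cross_def C' field_simps)
          \<comment> \<open>The eliminated row is nonzero, hence so is \<open>cross i p\<close>, and
            genericity of \<open>v\<close> rules out \<open>t i = t p\<close>.\<close>
          then have "cross i p \<in> W"
            using nzr Cpk i by (fastforce simp: W_def)
          ultimately have ne: "dot (C i) v - C i k * t p \<noteq> 0" using v(1) by force
          \<comment> \<open>Before the first hit no sign changes. A tie in absolute value is
            harmless, since \<open>t i = - t p\<close> still leaves \<open>t i - t p\<close> with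
            the sign of \<open>t i\<close>.\<close>
          have "\<bar>t p\<bar> \<le> \<bar>t i\<bar>" using p(2) i False by auto
          moreover have "t i \<noteq> t p" using ne d by auto
          ultimately have "sgn (t i - t p) = sgn (t i)" by (auto simp: sgn_if)
          then have "sgn (dot (C i) v - C i k * t p) = sgn (dot (C i) v)"
            unfolding d by (simp add: sgn_mult flip: right_diff_distrib)
          with ne \<sigma> s show ?thesis by simp
        qed
      qed
    qed
    then show ?thesis using Cpk(2) \<delta> by auto
  qed
qed

section \<open>Maximizers of the quadratic form\<close>

text \<open>The form is the squared norm of \<open>B^T x\<close>. This makes it nonnegative, so that
  \<open>- 1\<close> can mark an empty incumbent, and computable from \<open>r\<close> accumulators
  in one pass over the rows.\<close>

lemma quad_form_eq_norm:
  "quad_form r n B x = (\<Sum>j<r. (\<Sum>i<n. B i j * x i)\<^sup>2)"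
proof -
  have "quad_form r n B x = (\<Sum>i<n. \<Sum>k<n. \<Sum>j<r. (B i j * x i) * (B k j * x k))"
    unfolding quad_form_def by (simp add: sum_distrib_left sum_distrib_right algebra_simps)
  also have "\<dots> = (\<Sum>i<n. \<Sum>j<r. \<Sum>k<n. (B i j * x i) * (B k j * x k))"
    by (rule sum.cong[OF refl sum.swap])
  also have "\<dots> = (\<Sum>j<r. \<Sum>i<n. \<Sum>k<n. (B i j * x i) * (B k j * x k))"
    by (rule sum.swap)
  finally show ?thesis by (simp add: power2_eq_square sum_product)
qed

text \<open>The hypothesis compares products with entries of \<open>B\<close>, so the vectors may
  differ on zero rows.\<close>

lemma quad_form_cong:
  "(\<And>i j. i < n \<Longrightarrow> j < r \<Longrightarrow> B i j * x i = B i j * y i) \<Longrightarrow> quad_form r n B x = quad_form r n B y"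
  unfolding quad_form_eq_norm by (auto intro!: sum.cong arg_cong[where f = "\<lambda>x. x\<^sup>2"])

lemma quad_form_maximizer_exists:
  "\<exists>x. sign_vector n x \<and> (\<forall>y. sign_vector n y \<longrightarrow> quad_form r n B y \<le> quad_form r n B x)"
proof -
  \<comment> \<open>Sign vectors are arbitrary beyond \<open>n\<close>; restricting them to the
    first \<open>n\<close> indices leaves a finite set.\<close>
  let ?S = "{..<n} \<rightarrow>\<^sub>E {-1, 1::real}"
  have "finite ?S" by (simp add: finite_PiE)
  moreover have "restrict (\<lambda>_. 1) {..<n} \<in> ?S" by auto
  then have "?S \<noteq> {}" by blast
  ultimately have "Max (quad_form r n B ` ?S) \<in> quad_form r n B ` ?S"
    by (intro Max_in) auto
  then obtain x where x: "x \<in> ?S" "quad_form r n B x = Max (quad_form r n B ` ?S)" by auto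
  have "quad_form r n B y \<le> quad_form r n B x" if "sign_vector n y" for y
  proof -
    have "restrict y {..<n} \<in> ?S" using that by (auto simp: sign_vector_def)
    then have "quad_form r n B (restrict y {..<n}) \<le> quad_form r n B x"
      unfolding x(2) using \<open>finite ?S\<close> by (intro Max_ge) auto
    moreover have "quad_form r n B y = quad_form r n B (restrict y {..<n})"
      by (rule quad_form_cong) simp
    ultimately show ?thesis by simp
  qed
  moreover have "sign_vector n x" using x(1) by (auto simp: sign_vector_def PiE_iff)
  ultimately show ?thesis by blast
qed

text \<open>Flipping one sign of a maximizer cannot increase the form.\<close>

lemma maximizer_row_inner_ge:
  assumes x: "sign_vector n x" and max: "\<And>y. sign_vector n y \<Longrightarrow> quad_form r n B y \<le> quad_form r n B x"
    and i: "i < n"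
  shows "(\<Sum>j<r. (B i j)\<^sup>2) \<le> x i * (\<Sum>j<r. B i j * (\<Sum>k<n. B k j * x k))"
proof -
  define u where "u j = (\<Sum>k<n. B k j * x k)" for j
  define y where "y = x(i := - x i)"
  have "x i * x i = 1" using x i by (auto simp: sign_vector_def)
  have "sign_vector n y" using x i by (auto simp: sign_vector_def y_def)
  have "(\<Sum>k<n. B k j * y k) = u j - 2 * (B i j * x i)" for j
  proof -
    have "(\<Sum>k<n. B k j * y k) = (\<Sum>k<n. B k j * x k - (if k = i then 2 * (B i j * x i) else 0))"
      by (rule sum.cong) (auto simp: y_def)
    then show ?thesis using i by (simp add: sum_subtractf u_def)
  qed
  then have "quad_form r n B y = (\<Sum>j<r. (u j - 2 * (B i j * x i))\<^sup>2)"
    by (simp add: quad_form_eq_norm)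
  also have "\<dots> = (\<Sum>j<r. (u j)\<^sup>2 - 4 * (x i * (B i j * u j)) + 4 * (B i j)\<^sup>2)"
  proof (rule sum.cong)
    fix j
    have "(u j - 2 * (B i j * x i))\<^sup>2 = (u j)\<^sup>2 - 4 * (x i * (B i j * u j)) + 4 * (B i j)\<^sup>2 * (x i * x i)"
      by algebra
    then show "(u j - 2 * (B i j * x i))\<^sup>2 = (u j)\<^sup>2 - 4 * (x i * (B i j * u j)) + 4 * (B i j)\<^sup>2"
      using \<open>x i * x i = 1\<close> by simp
  qed simp
  also have "\<dots> = quad_form r n B x - 4 * (x i * (\<Sum>j<r. B i j * u j)) + 4 * (\<Sum>j<r. (B i j)\<^sup>2)"
    by (simp add: quad_form_eq_norm u_def sum.distrib sum_subtractf sum_distrib_left)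
  finally show ?thesis using max[OF \<open>sign_vector n y\<close>] by (simp add: u_def)
qed

lemma reachable_maximizer:
  assumes "n > 0"
  shows "\<exists>\<sigma>. reachable r n r 0 B (\<lambda>_. 1) \<sigma> \<and>
    (\<forall>y. sign_vector n y \<longrightarrow> quad_form r n B y \<le> quad_form r n B \<sigma>)"
proof -
  obtain x where x: "sign_vector n x" "\<And>y. sign_vector n y \<Longrightarrow> quad_form r n B y \<le> quad_form r n B x"
    using quad_form_maximizer_exists by blast
  define u where "u j = (\<Sum>k<n. B k j * x k)" for j
  \<comment> \<open>A row that is zero from the start never receives a sign and keeps the initial 1,
    so the maximizer is normalized there; its value is unaffected.\<close>
  define \<sigma> where "\<sigma> i = (if \<forall>j<r. B i j = 0 then 1 else x i)" for i
  have "reachable r n r 0 B (\<lambda>_. 1) \<sigma>"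
  proof (rule strict_pattern_reachable[where u = u])
    fix i assume i: "i < n"
    show "(\<forall>j\<in>{0..<r}. B i j = 0) \<and> \<sigma> i = 1 \<or>
      (\<Sum>j=0..<r. B i j * u j) \<noteq> 0 \<and> \<sigma> i = sgn (\<Sum>j=0..<r. B i j * u j)"
    proof (cases "\<forall>j<r. B i j = 0")
      case True
      then show ?thesis by (simp add: \<sigma>_def)
    next
      case False
      then obtain j where "j < r" "B i j \<noteq> 0" by blast
      then have "0 < (\<Sum>j<r. (B i j)\<^sup>2)" by (intro sum_pos2[of _ j]) auto
      also have "\<dots> \<le> x i * (\<Sum>j<r. B i j * u j)"
        unfolding u_def by (rule maximizer_row_inner_ge[OF x i])
      finally have pos: "0 < x i * (\<Sum>j<r. B i j * u j)" .
      have "x i = 1 \<or> x i = -1" using x(1) i by (auto simp: sign_vector_def)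
      with pos have "(\<Sum>j<r. B i j * u j) \<noteq> 0 \<and> x i = sgn (\<Sum>j<r. B i j * u j)" by auto
      moreover have "\<sigma> i = x i" using False unfolding \<sigma>_def by (rule if_not_P)
      ultimately show ?thesis by (simp add: atLeast0LessThan)
    qed
  qed (use assms in auto)
  moreover have "quad_form r n B \<sigma> = quad_form r n B x"
    by (rule quad_form_cong) (auto simp: \<sigma>_def)
  ultimately show ?thesis using x(2) by auto
qed

section \<open>Running times of structured programs\<close>

text \<open>A bound in \<open>n\<close> for executions in which every loop makes at most \<open>n\<close> iterations.\<close>

primrec time_poly :: "com \<Rightarrow> nat poly" where
  "time_poly Skip = [:1:]"
| "time_poly (ISet x e) = [:1 + icost e:]"
| "time_poly (RSet a e f) = [:1 + icost e + rcost f:]"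
| "time_poly (Seq c d) = time_poly c + time_poly d"
| "time_poly (Cond b c d) = [:bcost b:] + time_poly c + time_poly d"
| "time_poly (While b c) = [:bcost b:] + [:0, 1:] * ([:bcost b:] + time_poly c)"

text \<open>A total-correctness triple whose time bound is read off the program text, so that the
  rules below carry no time bookkeeping.\<close>

definition runs :: "nat \<Rightarrow> com \<Rightarrow> state \<Rightarrow> (state \<Rightarrow> bool) \<Rightarrow> bool" where
  "runs n c s Q \<longleftrightarrow> (\<exists>t s'. exec c s t s' \<and> t \<le> poly (time_poly c) n \<and> Q s')"

lemma runs_mono: "runs n c s Q \<Longrightarrow> (\<And>s'. Q s' \<Longrightarrow> R s') \<Longrightarrow> runs n c s R"
  unfolding runs_def by blast

lemma runs_Skip: "Q s \<Longrightarrow> runs n Skip s Q"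
  unfolding runs_def by (intro exI[of _ 1] exI[of _ s] conjI exec.Skip) auto

lemma runs_RSet:
  "Q (s\<lparr>arr := (arr s)(a := (arr s a)(ival e s := rval f s))\<rparr>) \<Longrightarrow> runs n (RSet a e f) s Q"
  unfolding runs_def by (intro exI[of _ "1 + icost e + rcost f"] exI conjI, rule exec.RSet) auto

lemma runs_Seq:
  assumes "runs n c s Q" "\<And>s'. Q s' \<Longrightarrow> runs n d s' R"
  shows "runs n (Seq c d) s R"
proof -
  from assms(1) obtain t s' where 1: "exec c s t s'" "t \<le> poly (time_poly c) n" "Q s'"
    by (auto simp: runs_def)
  from assms(2)[OF 1(3)] obtain u s'' where "exec d s' u s''" "u \<le> poly (time_poly d) n" "R s''"
    by (auto simp: runs_def)
  with 1 have "exec (Seq c d) s (t + u) s''" "t + u \<le> poly (time_poly (Seq c d)) n" "R s''"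
    by (auto intro: exec.Seq)
  then show ?thesis unfolding runs_def by blast
qed

lemma runs_Cond:
  assumes "bval b s \<Longrightarrow> runs n c s Q" "\<not> bval b s \<Longrightarrow> runs n d s Q"
  shows "runs n (Cond b c d) s Q"
proof (cases "bval b s")
  case True
  with assms obtain t s' where "exec c s t s'" "t \<le> poly (time_poly c) n" "Q s'"
    by (auto simp: runs_def)
  with True have "exec (Cond b c d) s (bcost b + t) s'"
    "bcost b + t \<le> poly (time_poly (Cond b c d)) n" "Q s'"
    by (auto intro: exec.CondT)
  then show ?thesis unfolding runs_def by blast
next
  case False
  with assms obtain t s' where "exec d s t s'" "t \<le> poly (time_poly d) n" "Q s'"
    by (auto simp: runs_def)
  with False have "exec (Cond b c d) s (bcost b + t) s'"
    "bcost b + t \<le> poly (time_poly (Cond b c d)) n" "Q s'"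
    by (auto intro: exec.CondF)
  then show ?thesis unfolding runs_def by blast
qed

definition for_rows :: "nat \<Rightarrow> com \<Rightarrow> com" where
  "for_rows x c = Seq (ISet x (INum 0))
     (While (ILess (IReg x) (IReg 0)) (Seq c (ISet x (IAdd (IReg x) (INum 1)))))"

text \<open>The body must re-establish the invariant for the state in which the counter has already
  been advanced, and it must preserve both the counter and the bound in register 0.\<close>

lemma runs_for_rows:
  assumes "x \<noteq> 0" "reg s 0 = n"
    and init: "I 0 (s\<lparr>reg := (reg s)(x := 0)\<rparr>)"
    and body: "\<And>i s. i < n \<Longrightarrow> I i s \<Longrightarrow> reg s x = i \<Longrightarrow> reg s 0 = n \<Longrightarrow>
      runs n c s (\<lambda>s'. reg s' x = i \<and> reg s' 0 = n \<and> I (Suc i) (s'\<lparr>reg := (reg s')(x := Suc i)\<rparr>))"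
  shows "runs n (for_rows x c) s (I n)"
proof -
  let ?b = "ILess (IReg x) (IReg 0)" and ?c = "Seq c (ISet x (IAdd (IReg x) (INum 1)))"
  \<comment> \<open>Each remaining iteration pays for one guard and one body; the additional
    \<open>bcost ?b\<close> is the failing guard at the end.\<close>
  have loop: "\<exists>t s'. exec (While ?b ?c) s t s' \<and>
      t \<le> bcost ?b + (n - i) * (bcost ?b + poly (time_poly ?c) n) \<and> I n s'"
    if "i \<le> n" "I i s" "reg s x = i" "reg s 0 = n" for i s
    using that
  proof (induction "n - i" arbitrary: i s)
    case 0
    then have "exec (While ?b ?c) s (bcost ?b) s" by (intro exec.WhileF) simp
    with 0 show ?case by (intro exI[of _ "bcost ?b"] exI[of _ s]) simp
  next
    case (Suc l)
    then have "i < n" by simp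
    from body[OF this Suc.prems(2-4)] obtain t s' where s': "exec c s t s'"
      "t \<le> poly (time_poly c) n" "reg s' x = i" "reg s' 0 = n"
      "I (Suc i) (s'\<lparr>reg := (reg s')(x := Suc i)\<rparr>)" by (auto simp: runs_def)
    let ?s = "s'\<lparr>reg := (reg s')(x := Suc i)\<rparr>"
    \<comment> \<open>One step for the assignment and three for the expression that adds 1.\<close>
    have "exec (ISet x (IAdd (IReg x) (INum 1))) s' 4 ?s"
      using exec.ISet[of x "IAdd (IReg x) (INum 1)" s'] s'(3) by (simp add: numeral_eq_Suc)
    with s'(1) have c: "exec ?c s (t + 4) ?s" by (rule exec.Seq)
    have "\<exists>t s'. exec (While ?b ?c) ?s t s' \<and>
        t \<le> bcost ?b + (n - Suc i) * (bcost ?b + poly (time_poly ?c) n) \<and> I n s'"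
      by (rule Suc.hyps(1)) (use Suc.hyps(2) \<open>i < n\<close> s'(4,5) assms(1) in simp_all)
    then obtain u s'' where u: "exec (While ?b ?c) ?s u s''"
      "u \<le> bcost ?b + (n - Suc i) * (bcost ?b + poly (time_poly ?c) n)" "I n s''" by blast
    have "exec (While ?b ?c) s (bcost ?b + (t + 4) + u) s''"
      using Suc.prems \<open>i < n\<close> by (intro exec.WhileT[OF _ c u(1)]) simp
    moreover have "bcost ?b + (t + 4) + u \<le> bcost ?b + (n - i) * (bcost ?b + poly (time_poly ?c) n)"
    proof -
      have "t + 4 \<le> poly (time_poly ?c) n" using s'(2) by simp
      then have "bcost ?b + (t + 4) + u \<le>
          bcost ?b + (bcost ?b + poly (time_poly ?c) n) +
          (n - Suc i) * (bcost ?b + poly (time_poly ?c) n)"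
        using u(2) by linarith
      also have "\<dots> = bcost ?b + Suc (n - Suc i) * (bcost ?b + poly (time_poly ?c) n)" by simp
      also have "Suc (n - Suc i) = n - i" using \<open>i < n\<close> by simp
      finally show ?thesis .
    qed
    ultimately show ?case using u(3) by blast
  qed
  let ?s0 = "s\<lparr>reg := (reg s)(x := 0)\<rparr>"
  from loop[of 0 ?s0] init assms(1,2) obtain t s' where
    t: "exec (While ?b ?c) ?s0 t s'" "t \<le> poly (time_poly (While ?b ?c)) n" "I n s'"
    by auto
  have "exec (ISet x (INum 0)) s 2 ?s0" using exec.ISet[of x "INum 0" s] by (simp add: numeral_2_eq_2)
  then have "exec (for_rows x c) s (2 + t) s'"
    unfolding for_rows_def using t(1) by (rule exec.Seq)
  moreover have "2 + t \<le> poly (time_poly (for_rows x c)) n"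
    using t(2) unfolding for_rows_def by simp
  ultimately show ?thesis using t(3) unfolding runs_def by blast
qed

text \<open>Array names are literals of the language, so a loop over columns has to be unrolled when
  the program is built; for fixed \<open>r\<close> this is a constant factor.\<close>

primrec seq_upto :: "(nat \<Rightarrow> com) \<Rightarrow> nat \<Rightarrow> com" where
  "seq_upto f 0 = Skip"
| "seq_upto f (Suc j) = Seq (seq_upto f j) (f j)"

lemma runs_seq_upto:
  assumes "I 0 s" "\<And>j s. j < m \<Longrightarrow> I j s \<Longrightarrow> runs n (f j) s (I (Suc j))"
  shows "runs n (seq_upto f m) s (I m)"
  using assms
proof (induction m)
  case 0
  then show ?case by (simp add: runs_Skip)
next
  case (Suc m)
  then have "runs n (seq_upto f m) s (I m)" by simp
  then show ?case using Suc.prems(2)[of m] by (auto intro: runs_Seq)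
qed

text \<open>The machine does not multiply naturals; a constant factor becomes repeated
  addition.\<close>

primrec imult :: "nat \<Rightarrow> iexp \<Rightarrow> iexp" where
  "imult 0 e = INum 0"
| "imult (Suc m) e = IAdd (imult m e) e"

lemma ival_imult [simp]: "ival (imult m e) s = m * ival e s"
  by (induction m) auto

primrec rsum :: "(nat \<Rightarrow> rexp) \<Rightarrow> nat \<Rightarrow> rexp" where
  "rsum f 0 = RNum 0"
| "rsum f (Suc m) = RAdd (rsum f m) (f m)"

lemma rval_rsum [simp]: "rval (rsum f m) s = (\<Sum>j<m. rval (f j) s)"
  by (induction m) auto

section \<open>The search program\<close>

text \<open>
  Level \<open>k\<close> of the elimination is stored column by column: cell \<open>i\<close> of array \<open>col r k j\<close> is
  the entry in row \<open>i\<close> and column \<open>j\<close>, and column \<open>r\<close> holds the signs. The pivot row of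
  level \<open>k\<close> is held in register \<open>k + 2\<close>. Register 1 is the counter of the inner loops, and
  array 3 accumulates the entries of \<open>B\<^sup>T x\<close>.
\<close>

definition col :: "nat \<Rightarrow> nat \<Rightarrow> nat \<Rightarrow> nat" where
  "col r k j = 4 + k * Suc r + j"

text \<open>Each level occupies a block of \<open>Suc r\<close> arrays, so division by
  \<open>Suc r\<close> recovers the level. The offset 4 clears the arrays for input, maximizer,
  maximum and accumulator.\<close>

lemma col_eq_iff [simp]: "j \<le> r \<Longrightarrow> j' \<le> r \<Longrightarrow> col r k j = col r k' j' \<longleftrightarrow> k = k' \<and> j = j'"
proof
  have div: "(col r k j - 4) div Suc r = k" if "j \<le> r" for j k
    using that by (intro div_nat_eqI) (auto simp: col_def)
  assume "j \<le> r" "j' \<le> r" and eq: "col r k j = col r k' j'"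
  with div[of j k] div[of j' k'] have "k = k'" by simp
  with eq show "k = k' \<and> j = j'" by (simp add: col_def)
qed simp

lemma col_ge: "col r k j \<ge> 4"
  by (simp add: col_def)

lemma col_neq [simp]: "col r k j \<noteq> 0" "col r k j \<noteq> 1" "col r k j \<noteq> Suc 0" "col r k j \<noteq> 2" "col r k j \<noteq> 3"
  "0 \<noteq> col r k j" "1 \<noteq> col r k j" "Suc 0 \<noteq> col r k j" "2 \<noteq> col r k j" "3 \<noteq> col r k j"
  by (auto simp: col_def)

lemma col_less_level: "j \<le> r \<Longrightarrow> k < l \<Longrightarrow> col r k j < col r l 0"
proof -
  assume "j \<le> r" "k < l"
  then have "Suc k * Suc r \<le> l * Suc r" by (intro mult_le_mono1) simp
  with \<open>j \<le> r\<close> show ?thesis by (simp add: col_def)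
qed

lemma col_mem_level_iff [simp]: "j \<le> r \<Longrightarrow> col r k j \<in> col r l ` {..r} \<longleftrightarrow> k = l"
  by auto

lemma below_level_not_mem [simp]: "a < col r l 0 \<Longrightarrow> a \<notin> col r l ` {..r}"
  by (auto simp: col_def)

lemma below_4_not_mem [simp]: "a < 4 \<Longrightarrow> a \<notin> col r l ` {..r}"
  by (auto simp: col_def)

lemma level_le: "k \<le> l \<Longrightarrow> col r k 0 \<le> col r l 0"
  unfolding col_def by (intro add_mono mult_le_mono1) simp_all

definition fill_level :: "nat \<Rightarrow> nat \<Rightarrow> (nat \<Rightarrow> rexp) \<Rightarrow> com \<Rightarrow> com" where
  "fill_level r k f g =
     for_rows 1 (Seq (seq_upto (\<lambda>j. RSet (col r k j) (IReg 1) (f j)) r) g)"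

definition load :: "nat \<Rightarrow> com" where
  "load r = fill_level r 0 (\<lambda>j. RArr 0 (IAdd (imult r (IReg 1)) (INum j)))
     (RSet (col r 0 r) (IReg 1) (RNum 1))"

definition quotient :: "nat \<Rightarrow> nat \<Rightarrow> rexp" where
  "quotient r k = RDiv (RArr (col r k k) (IReg 1)) (RArr (col r k k) (IReg (k + 2)))"

text \<open>Level \<open>k\<close> is only read and level \<open>Suc k\<close> written, so trying
  another pivot requires no undoing.\<close>

definition eliminate :: "nat \<Rightarrow> nat \<Rightarrow> int \<Rightarrow> com" where
  "eliminate r k \<delta> = fill_level r (Suc k)
     (\<lambda>j. RSub (RArr (col r k j) (IReg 1)) (RMul (quotient r k) (RArr (col r k j) (IReg (k + 2)))))
     (Cond (RLess (RNum 0) (quotient r k)) (RSet (col r (Suc k) r) (IReg 1) (RNum \<delta>))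
       (Cond (RLess (quotient r k) (RNum 0)) (RSet (col r (Suc k) r) (IReg 1) (RNum (- \<delta>)))
         (RSet (col r (Suc k) r) (IReg 1) (RArr (col r k r) (IReg 1)))))"

definition square_norm :: "nat \<Rightarrow> rexp" where
  "square_norm r = rsum (\<lambda>j. RMul (RArr 3 (INum j)) (RArr 3 (INum j))) r"

definition evaluate :: "nat \<Rightarrow> nat \<Rightarrow> com" where
  "evaluate r k =
     Seq (seq_upto (\<lambda>j. RSet 3 (INum j) (RNum 0)) r)
    (Seq (for_rows 1 (seq_upto (\<lambda>j. RSet 3 (INum j)
            (RAdd (RArr 3 (INum j)) (RMul (RArr (col r 0 j) (IReg 1)) (RArr (col r k r) (IReg 1))))) r))
      (Cond (RLess (RArr 2 (INum 0)) (square_norm r))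
        (Seq (RSet 2 (INum 0) (square_norm r))
          (for_rows 1 (RSet 1 (IReg 1) (RArr (col r k r) (IReg 1)))))
        Skip))"

text \<open>The recursion happens while building the program: the result has \<open>m\<close> nested
  loops over the rows, and its text doubles at each level for the two signs, which is constant for
  fixed \<open>r\<close>.\<close>

primrec search :: "nat \<Rightarrow> nat \<Rightarrow> nat \<Rightarrow> com" where
  "search r 0 k = evaluate r k"
| "search r (Suc m) k = for_rows (k + 2)
     (Seq (Seq (eliminate r k 1) (search r m (Suc k)))
       (Seq (eliminate r k (- 1)) (search r m (Suc k))))"

text \<open>Evaluating the all-ones vector before the search covers \<open>n = 0\<close>, where for
  positive \<open>r\<close> the pivot loops are empty and the search stores nothing.\<close>

definition maximize :: "nat \<Rightarrow> com" where
  "maximize r =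
     Seq (load r) (Seq (RSet 2 (INum 0) (RNum (- 1))) (Seq (evaluate r 0) (search r r 0)))"

section \<open>Correctness of the subprograms and what they leave unchanged\<close>

definition same_except :: "nat set \<Rightarrow> state \<Rightarrow> state \<Rightarrow> bool" where
  "same_except A s s' \<longleftrightarrow> (\<forall>x. x \<noteq> 1 \<longrightarrow> reg s' x = reg s x) \<and>
    (\<forall>a. a \<notin> A \<longrightarrow> arr s' a = arr s a)"

text \<open>\<open>f\<close> and \<open>g\<close> are executed when part of level \<open>k\<close>
  has already been overwritten, so their effect must be the same in all states that agree with
  \<open>s\<close> off that level.\<close>

lemma runs_fill_level:
  assumes "reg s 0 = n"
    and f: "\<And>s' i j. same_except (col r k ` {..r}) s s' \<Longrightarrow> reg s' 1 = i \<Longrightarrow> i < n \<Longrightarrow> j < r \<Longrightarrow> rval (f j) s' = v i j"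
    and g: "\<And>s' i. same_except (col r k ` {..r}) s s' \<Longrightarrow> reg s' 1 = i \<Longrightarrow> i < n \<Longrightarrow>
      runs n g s' (\<lambda>s''. s'' = s'\<lparr>arr := (arr s')(col r k r := (arr s' (col r k r))(i := w i))\<rparr>)"
  shows "runs n (fill_level r k f g) s
    (\<lambda>s'. same_except (col r k ` {..r}) s s' \<and> (\<forall>i<n. (\<forall>j<r. arr s' (col r k j) i = v i j) \<and> arr s' (col r k r) i = w i))"
proof -
  \<comment> \<open>Progress is lexicographic: rows before \<open>i\<close> are complete with their
    signs, row \<open>i\<close> is filled up to column \<open>j\<close>.\<close>
  define P where "P i j s' \<longleftrightarrow> same_except (col r k ` {..r}) s s' \<and>
    (\<forall>l j'. j' < r \<longrightarrow> l < i \<or> l = i \<and> j' < j \<longrightarrow> arr s' (col r k j') l = v l j') \<and>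
    (\<forall>l<i. arr s' (col r k r) l = w l)" for i j s'
  have "runs n (fill_level r k f g) s (P n 0)"
    unfolding fill_level_def
  proof (rule runs_for_rows)
    show "P 0 0 (s\<lparr>reg := (reg s)(1 := 0)\<rparr>)" by (simp add: P_def same_except_def)
    fix i s1 assume i: "i < n" "P i 0 s1" "reg s1 1 = i" "reg s1 0 = n"
    have cols: "runs n (seq_upto (\<lambda>j. RSet (col r k j) (IReg 1) (f j)) r) s1
        (\<lambda>s'. P i r s' \<and> reg s' 1 = i)"
    proof (rule runs_seq_upto)
      show "P i 0 s1 \<and> reg s1 1 = i" using i by simp
      fix j s2 assume j: "j < r" and s2: "P i j s2 \<and> reg s2 1 = i"
      then have "rval (f j) s2 = v i j" using f i(1) by (simp add: P_def)
      then show "runs n (RSet (col r k j) (IReg 1) (f j)) s2 (\<lambda>s'. P i (Suc j) s' \<and> reg s' 1 = i)"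
        using s2 j by (intro runs_RSet) (auto simp: P_def same_except_def less_Suc_eq)
    qed
    show "runs n (Seq (seq_upto (\<lambda>j. RSet (col r k j) (IReg 1) (f j)) r) g) s1
      (\<lambda>s'. reg s' 1 = i \<and> reg s' 0 = n \<and> P (Suc i) 0 (s'\<lparr>reg := (reg s')(1 := Suc i)\<rparr>))"
    proof (rule runs_Seq[OF cols])
      fix s2 assume s2: "P i r s2 \<and> reg s2 1 = i"
      then have "same_except (col r k ` {..r}) s s2" by (simp add: P_def)
      from g[OF this _ i(1)] s2 have "runs n g s2
        (\<lambda>s''. s'' = s2\<lparr>arr := (arr s2)(col r k r := (arr s2 (col r k r))(i := w i))\<rparr>)" by blast
      then show "runs n g s2
        (\<lambda>s'. reg s' 1 = i \<and> reg s' 0 = n \<and> P (Suc i) 0 (s'\<lparr>reg := (reg s')(1 := Suc i)\<rparr>))"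
      proof (rule runs_mono)
        fix s' assume "s' = s2\<lparr>arr := (arr s2)(col r k r := (arr s2 (col r k r))(i := w i))\<rparr>"
        then show "reg s' 1 = i \<and> reg s' 0 = n \<and> P (Suc i) 0 (s'\<lparr>reg := (reg s')(1 := Suc i)\<rparr>)"
          using s2 assms(1) by (auto simp: P_def same_except_def less_Suc_eq)
      qed
    qed
  qed (use assms(1) in simp_all)
  then show ?thesis by (rule runs_mono) (auto simp: P_def)
qed

lemma runs_load:
  assumes "reg s 0 = n"
  shows "runs n (load r) s (\<lambda>s'. reg s' 0 = n \<and>
    (\<forall>i<n. (\<forall>j<r. arr s' (col r 0 j) i = arr s 0 (i * r + j)) \<and> arr s' (col r 0 r) i = 1))"
  unfolding load_def
  by (rule runs_mono, rule runs_fill_level[where v = "\<lambda>i j. arr s 0 (i * r + j)" and w = "\<lambda>_. 1", OF assms])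
    (auto simp: same_except_def assms mult.commute intro!: runs_RSet)

definition matrix_at :: "nat \<Rightarrow> nat \<Rightarrow> state \<Rightarrow> nat \<Rightarrow> nat \<Rightarrow> real" where
  "matrix_at r k s = (\<lambda>i j. arr s (col r k j) i)"

definition signs_at :: "nat \<Rightarrow> nat \<Rightarrow> state \<Rightarrow> nat \<Rightarrow> real" where
  "signs_at r k s = arr s (col r k r)"

text \<open>What a nested search must preserve for the loops around it: \<open>n\<close>, their
  pivot registers and their levels. Register 1 is scratch, and arrays 0 to 3 are exempt because the
  search reads the matrix from its copy in level 0.\<close>

definition keeps :: "nat \<Rightarrow> nat \<Rightarrow> state \<Rightarrow> state \<Rightarrow> bool" where
  "keeps y z s s' \<longleftrightarrow> (\<forall>x. x = 0 \<or> 2 \<le> x \<and> x < y \<longrightarrow> reg s' x = reg s x) \<and>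
     (\<forall>a. 4 \<le> a \<and> a < z \<longrightarrow> arr s' a = arr s a)"

lemma keeps_refl: "keeps y z s s"
  by (simp add: keeps_def)

lemma keeps_trans: "keeps y z s s' \<Longrightarrow> keeps y z s' s'' \<Longrightarrow> keeps y z s s''"
  by (simp add: keeps_def)

lemma keeps_mono: "keeps y z s s' \<Longrightarrow> y' \<le> y \<Longrightarrow> z' \<le> z \<Longrightarrow> keeps y' z' s s'"
  by (auto simp: keeps_def)

lemma keeps_matrix_at:
  "keeps y (col r (Suc k) 0) s s' \<Longrightarrow> l \<le> k \<Longrightarrow> j \<le> r \<Longrightarrow> matrix_at r l s' i j = matrix_at r l s i j"
  using col_less_level[of j r l "Suc k"] by (simp add: keeps_def matrix_at_def col_ge)

lemma keeps_signs_at: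
  "keeps y (col r (Suc k) 0) s s' \<Longrightarrow> l \<le> k \<Longrightarrow> signs_at r l s' = signs_at r l s"
  using col_less_level[of r r l "Suc k"] by (simp add: keeps_def signs_at_def col_ge)

lemma runs_eliminate:
  assumes "reg s 0 = n" "k < r"
  shows "runs n (eliminate r k \<delta>) s (\<lambda>s'. keeps y (col r (Suc k) 0) s s' \<and>
    arr s' 1 = arr s 1 \<and> arr s' 2 = arr s 2 \<and>
    eliminated r n k (reg s (k + 2)) (of_int \<delta>) (matrix_at r k s) (signs_at r k s)
      (matrix_at r (Suc k) s') (signs_at r (Suc k) s'))"
proof -
  let ?C = "matrix_at r k s" and ?X = "signs_at r k s" and ?p = "reg s (k + 2)"
  let ?w = "\<lambda>i. if ?C i k / ?C ?p k > 0 then of_int \<delta> else if ?C i k / ?C ?p k < 0 then - of_int \<delta> else ?X i"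
  have q: "rval (quotient r k) s' = ?C (reg s' 1) k / ?C ?p k"
    if "same_except (col r (Suc k) ` {..r}) s s'" for s'
    using that assms(2) by (simp add: quotient_def matrix_at_def same_except_def)
  show ?thesis
    unfolding eliminate_def
  proof (rule runs_mono, rule runs_fill_level[where v = "\<lambda>i j. ?C i j - ?C i k / ?C ?p k * ?C ?p j" and w = ?w])
    show "reg s 0 = n" by fact
  next
    fix s' i j
    assume s': "same_except (col r (Suc k) ` {..r}) s s'" "reg s' 1 = i" "j < r"
    then show "rval (RSub (RArr (col r k j) (IReg 1))
        (RMul (quotient r k) (RArr (col r k j) (IReg (k + 2))))) s' =
        ?C i j - ?C i k / ?C ?p k * ?C ?p j"
      using assms(2) by (simp add: q) (simp add: same_except_def matrix_at_def)
  next
    fix s' i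
    assume s': "same_except (col r (Suc k) ` {..r}) s s'" "reg s' 1 = i"
    then show "runs n (Cond (RLess (RNum 0) (quotient r k)) (RSet (col r (Suc k) r) (IReg 1) (RNum \<delta>))
       (Cond (RLess (quotient r k) (RNum 0)) (RSet (col r (Suc k) r) (IReg 1) (RNum (- \<delta>)))
         (RSet (col r (Suc k) r) (IReg 1) (RArr (col r k r) (IReg 1))))) s'
       (\<lambda>s''. s'' = s'\<lparr>arr := (arr s')(col r (Suc k) r := (arr s' (col r (Suc k) r))(i := ?w i))\<rparr>)"
      by (intro runs_Cond runs_RSet) (auto simp: q, auto simp: same_except_def signs_at_def)
  next
    fix s'
    assume s': "same_except (col r (Suc k) ` {..r}) s s' \<and>
      (\<forall>i<n. (\<forall>j<r. arr s' (col r (Suc k) j) i = ?C i j - ?C i k / ?C ?p k * ?C ?p j) \<and>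
        arr s' (col r (Suc k) r) i = ?w i)"
    have "arr s' a = arr s a" if "a < col r (Suc k) 0" for a
      using s' that by (simp add: same_except_def)
    moreover have "arr s' 1 = arr s 1" "arr s' 2 = arr s 2" using s' by (simp_all add: same_except_def)
    ultimately show "keeps y (col r (Suc k) 0) s s' \<and> arr s' 1 = arr s 1 \<and> arr s' 2 = arr s 2 \<and>
      eliminated r n k ?p (of_int \<delta>) ?C ?X (matrix_at r (Suc k) s') (signs_at r (Suc k) s')"
      using s' unfolding eliminated_def keeps_def
      by (simp add: same_except_def matrix_at_def[of r "Suc k"] signs_at_def[of r "Suc k"])
  qed
qed

text \<open>The initial value \<open>- 1\<close> marks that no candidate has been stored yet.\<close>

definition incumbent :: "nat \<Rightarrow> nat \<Rightarrow> (nat \<Rightarrow> nat \<Rightarrow> real) \<Rightarrow> state \<Rightarrow> bool" where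
  "incumbent r n B s \<longleftrightarrow> arr s 2 0 = - 1 \<or>
     sign_vector n (arr s 1) \<and> arr s 2 0 = quad_form r n B (arr s 1)"

lemma runs_evaluate:
  assumes n: "reg s 0 = n" and B: "\<And>i j. i < n \<Longrightarrow> j < r \<Longrightarrow> matrix_at r 0 s i j = B i j"
    and inc: "incumbent r n B s" and X: "sign_vector n (signs_at r k s)"
  shows "runs n (evaluate r k) s (\<lambda>s'. keeps y z s s' \<and> incumbent r n B s' \<and>
    arr s 2 0 \<le> arr s' 2 0 \<and> quad_form r n B (signs_at r k s) \<le> arr s' 2 0)"
proof -
  let ?X = "signs_at r k s"
  have 1: "runs n (seq_upto (\<lambda>j. RSet 3 (INum j) (RNum 0)) r) s
      (\<lambda>s1. same_except {3} s s1 \<and> (\<forall>j<r. arr s1 3 j = 0))"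
    by (rule runs_seq_upto[where I = "\<lambda>j s1. same_except {3} s s1 \<and> (\<forall>j'<j. arr s1 3 j' = 0)"])
      (auto simp: same_except_def less_Suc_eq intro!: runs_RSet)
  \<comment> \<open>While row \<open>i\<close> is processed, the accumulators below \<open>j\<close>
    already include its term.\<close>
  define P where "P i j s1 \<longleftrightarrow> same_except {3} s s1 \<and>
    (\<forall>j'<r. arr s1 3 j' = (\<Sum>l<(if j' < j then Suc i else i). B l j' * ?X l))" for i j s1
  have 2: "runs n (for_rows 1 (seq_upto (\<lambda>j. RSet 3 (INum j)
      (RAdd (RArr 3 (INum j)) (RMul (RArr (col r 0 j) (IReg 1)) (RArr (col r k r) (IReg 1))))) r))
      s1 (P n 0)" if s1: "same_except {3} s s1 \<and> (\<forall>j<r. arr s1 3 j = 0)" for s1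
  proof (rule runs_for_rows)
    show "P 0 0 (s1\<lparr>reg := (reg s1)(1 := 0)\<rparr>)" using s1 by (simp add: P_def same_except_def)
    show "reg s1 0 = n" using s1 n by (simp add: same_except_def)
    fix i s2 assume i: "i < n" "P i 0 s2" "reg s2 1 = i" "reg s2 0 = n"
    have "runs n (seq_upto (\<lambda>j. RSet 3 (INum j)
      (RAdd (RArr 3 (INum j)) (RMul (RArr (col r 0 j) (IReg 1)) (RArr (col r k r) (IReg 1))))) r)
      s2 (\<lambda>s'. P i r s' \<and> reg s' 1 = i \<and> reg s' 0 = n)"
    proof (rule runs_seq_upto)
      show "P i 0 s2 \<and> reg s2 1 = i \<and> reg s2 0 = n" using i by simp
      fix j s3 assume j: "j < r" and s3: "P i j s3 \<and> reg s3 1 = i \<and> reg s3 0 = n"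
      have "arr s3 (col r 0 j) i = B i j" "arr s3 (col r k r) i = ?X i"
        using s3 B[OF i(1) j] by (simp_all add: P_def same_except_def matrix_at_def signs_at_def)
      then show "runs n (RSet 3 (INum j) (RAdd (RArr 3 (INum j))
          (RMul (RArr (col r 0 j) (IReg 1)) (RArr (col r k r) (IReg 1))))) s3
          (\<lambda>s'. P i (Suc j) s' \<and> reg s' 1 = i \<and> reg s' 0 = n)"
        using s3 j by (intro runs_RSet) (auto simp: P_def same_except_def less_Suc_eq)
    qed
    then show "runs n (seq_upto (\<lambda>j. RSet 3 (INum j)
      (RAdd (RArr 3 (INum j)) (RMul (RArr (col r 0 j) (IReg 1)) (RArr (col r k r) (IReg 1))))) r)
      s2 (\<lambda>s'. reg s' 1 = i \<and> reg s' 0 = n \<and> P (Suc i) 0 (s'\<lparr>reg := (reg s')(1 := Suc i)\<rparr>))"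
      by (rule runs_mono) (auto simp: P_def same_except_def)
  qed simp
  have 3: "runs n (Cond (RLess (RArr 2 (INum 0)) (square_norm r))
        (Seq (RSet 2 (INum 0) (square_norm r))
          (for_rows 1 (RSet 1 (IReg 1) (RArr (col r k r) (IReg 1)))))
        Skip) s1 (\<lambda>s'. keeps y z s s' \<and> incumbent r n B s' \<and>
    arr s 2 0 \<le> arr s' 2 0 \<and> quad_form r n B ?X \<le> arr s' 2 0)" if "P n 0 s1" for s1
  proof -
    have s1: "same_except {3} s s1" and acc: "\<And>j. j < r \<Longrightarrow> arr s1 3 j = (\<Sum>l<n. B l j * ?X l)"
      using that by (auto simp: P_def)
    have v: "rval (square_norm r) s1 = quad_form r n B ?X"
      using acc by (simp add: square_norm_def quad_form_eq_norm power2_eq_square)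
    have X1: "arr s1 (col r k r) = ?X" using s1 by (simp add: same_except_def signs_at_def)
    have keep: "keeps y z s s'" if "same_except {1, 2, 3} s s'" for s'
      using that by (auto simp: keeps_def same_except_def)
    show ?thesis
    proof (rule runs_Cond)
      assume lt: "bval (RLess (RArr 2 (INum 0)) (square_norm r)) s1"
      then have lt: "arr s 2 0 < quad_form r n B ?X" using s1 v by (simp add: same_except_def)
      define Q where "Q i s' \<longleftrightarrow> same_except {1, 2, 3} s s' \<and> arr s' 2 0 = quad_form r n B ?X \<and>
        (\<forall>l<i. arr s' 1 l = ?X l)" for i s'
      show "runs n (Seq (RSet 2 (INum 0) (square_norm r))
          (for_rows 1 (RSet 1 (IReg 1) (RArr (col r k r) (IReg 1))))) s1
          (\<lambda>s'. keeps y z s s' \<and> incumbent r n B s' \<and>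
            arr s 2 0 \<le> arr s' 2 0 \<and> quad_form r n B ?X \<le> arr s' 2 0)"
      proof (rule runs_Seq)
        show "runs n (RSet 2 (INum 0) (square_norm r)) s1 (Q 0)"
          using s1 v by (intro runs_RSet) (auto simp: Q_def same_except_def)
        fix s2 assume s2: "Q 0 s2"
        have "runs n (for_rows 1 (RSet 1 (IReg 1) (RArr (col r k r) (IReg 1)))) s2 (Q n)"
        proof (rule runs_for_rows)
          show "reg s2 0 = n" using s2 n by (simp add: Q_def same_except_def)
          show "Q 0 (s2\<lparr>reg := (reg s2)(1 := 0)\<rparr>)" using s2 by (simp add: Q_def same_except_def)
          fix i s3 assume s3: "i < n" "Q i s3" "reg s3 1 = i" "reg s3 0 = n"
          then have "arr s3 (col r k r) = ?X" by (simp add: Q_def same_except_def signs_at_def)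
          then show "runs n (RSet 1 (IReg 1) (RArr (col r k r) (IReg 1))) s3
            (\<lambda>s'. reg s' 1 = i \<and> reg s' 0 = n \<and> Q (Suc i) (s'\<lparr>reg := (reg s')(1 := Suc i)\<rparr>))"
            using s3 by (intro runs_RSet) (auto simp: Q_def same_except_def less_Suc_eq)
        qed simp
        then show "runs n (for_rows 1 (RSet 1 (IReg 1) (RArr (col r k r) (IReg 1)))) s2
          (\<lambda>s'. keeps y z s s' \<and> incumbent r n B s' \<and>
            arr s 2 0 \<le> arr s' 2 0 \<and> quad_form r n B ?X \<le> arr s' 2 0)"
        proof (rule runs_mono)
          fix s' assume s': "Q n s'"
          have "sign_vector n (arr s' 1)" using s' X by (simp add: Q_def sign_vector_def)
          moreover have "quad_form r n B (arr s' 1) = quad_form r n B ?X"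
            using s' by (intro quad_form_cong) (simp add: Q_def)
          ultimately show "keeps y z s s' \<and> incumbent r n B s' \<and>
            arr s 2 0 \<le> arr s' 2 0 \<and> quad_form r n B ?X \<le> arr s' 2 0"
            using s' keep lt by (simp add: Q_def incumbent_def)
        qed
      qed
    next
      assume "\<not> bval (RLess (RArr 2 (INum 0)) (square_norm r)) s1"
      then have "quad_form r n B ?X \<le> arr s1 2 0" using v by simp
      moreover have "incumbent r n B s1" using inc s1 by (simp add: incumbent_def same_except_def)
      moreover have "keeps y z s s1" "arr s1 2 = arr s 2"
        using s1 by (auto intro: keep simp: same_except_def)
      ultimately show "runs n Skip s1 (\<lambda>s'. keeps y z s s' \<and> incumbent r n B s' \<and>
            arr s 2 0 \<le> arr s' 2 0 \<and> quad_form r n B ?X \<le> arr s' 2 0)"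
        by (intro runs_Skip) simp
    qed
  qed
  show ?thesis unfolding evaluate_def by (rule runs_Seq[OF 1 runs_Seq[OF 2 3]])
qed

lemma runs_search:
  assumes "r = k + m" and n: "reg s 0 = n"
    and B: "\<And>i j. i < n \<Longrightarrow> j < r \<Longrightarrow> matrix_at r 0 s i j = B i j"
    and inc: "incumbent r n B s" and X: "sign_vector n (signs_at r k s)"
  shows "runs n (search r m k) s (\<lambda>s'. keeps (k + 2) (col r (Suc k) 0) s s' \<and> incumbent r n B s' \<and>
    arr s 2 0 \<le> arr s' 2 0 \<and>
    (\<forall>\<sigma>. reachable r n m k (matrix_at r k s) (signs_at r k s) \<sigma> \<longrightarrow> quad_form r n B \<sigma> \<le> arr s' 2 0))"
  using assms
proof (induction m arbitrary: k s)
  case 0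
  have eq: "quad_form r n B \<sigma> = quad_form r n B (signs_at r k s)"
    if "\<forall>i<n. \<sigma> i = signs_at r k s i" for \<sigma>
    using that by (intro quad_form_cong) simp
  have "runs n (evaluate r k) s (\<lambda>s'. keeps (k + 2) (col r (Suc k) 0) s s' \<and>
      incumbent r n B s' \<and> arr s 2 0 \<le> arr s' 2 0 \<and> quad_form r n B (signs_at r k s) \<le> arr s' 2 0)"
    by (rule runs_evaluate) (fact 0)+
  then show ?case
    unfolding search.simps reachable.simps by (rule runs_mono) (metis eq)
next
  case (Suc m)
  have kr: "k < r" "r = Suc k + m" using Suc.prems(1) by auto
  let ?K = "keeps (k + 2) (col r (Suc k) 0)"
  let ?C = "matrix_at r k s" and ?X = "signs_at r k s"
  \<comment> \<open>All candidates behind pivot \<open>p\<close> and sign \<open>\<delta>\<close>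
    are dominated by the stored maximum. The quantifier over \<open>C'\<close> and \<open>X'\<close>
    mirrors \<open>reachable\<close> and is instantiated with the level actually computed.\<close>
  define found where "found p \<delta> s' \<longleftrightarrow>
    (\<forall>\<sigma>. (\<forall>C' X'. eliminated r n k p \<delta> ?C ?X C' X' \<longrightarrow> reachable r n m (Suc k) C' X' \<sigma>) \<longrightarrow>
      quad_form r n B \<sigma> \<le> arr s' 2 0)" for p \<delta> and s' :: state
  define Inv where "Inv s' \<longleftrightarrow> ?K s s' \<and> incumbent r n B s' \<and> arr s 2 0 \<le> arr s' 2 0" for s'
  have branch: "runs n (Seq (eliminate r k \<delta>) (search r m (Suc k))) s1
      (\<lambda>s'. Inv s' \<and> reg s' (k + 2) = p \<and> arr s1 2 0 \<le> arr s' 2 0 \<and> found p (of_int \<delta>) s')"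
    if s1: "Inv s1" "reg s1 (k + 2) = p" and \<delta>: "\<delta> \<in> {1, -1}" for s1 p and \<delta> :: int
  proof (rule runs_Seq)
    have K1: "?K s s1" using s1 by (simp add: Inv_def)
    have n1: "reg s1 0 = n" using K1 Suc.prems(2) by (simp add: keeps_def)
    \<comment> \<open>The bound \<open>k + 3\<close> instead of \<open>k + 2\<close> includes the
      pivot register of this level, which is the counter of the enclosing loop.\<close>
    show "runs n (eliminate r k \<delta>) s1 (\<lambda>s'. keeps (k + 3) (col r (Suc k) 0) s1 s' \<and>
      arr s' 1 = arr s1 1 \<and> arr s' 2 = arr s1 2 \<and>
      eliminated r n k (reg s1 (k + 2)) (of_int \<delta>) (matrix_at r k s1) (signs_at r k s1)
        (matrix_at r (Suc k) s') (signs_at r (Suc k) s'))"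
      by (rule runs_eliminate[OF n1 kr(1)])
    fix s2 assume s2: "keeps (k + 3) (col r (Suc k) 0) s1 s2 \<and>
      arr s2 1 = arr s1 1 \<and> arr s2 2 = arr s1 2 \<and>
      eliminated r n k (reg s1 (k + 2)) (of_int \<delta>) (matrix_at r k s1) (signs_at r k s1)
        (matrix_at r (Suc k) s2) (signs_at r (Suc k) s2)"
    have "?K s1 s2" by (rule keeps_mono[OF conjunct1[OF s2]]) simp_all
    with K1 have K2: "?K s s2" by (rule keeps_trans)
    have p2: "reg s2 (k + 2) = p" using s2 s1(2) by (simp add: keeps_def)
    have el: "eliminated r n k p (of_int \<delta>) ?C ?X (matrix_at r (Suc k) s2) (signs_at r (Suc k) s2)"
    proof -
      have "matrix_at r k s1 i j = ?C i j" if "j < r" for i j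
        using keeps_matrix_at[OF K1] that by simp
      then show ?thesis
        using s2 s1(2) keeps_signs_at[OF K1, of k] kr(1) by (simp add: eliminated_def)
    qed
    have "runs n (search r m (Suc k)) s2 (\<lambda>s'. keeps (Suc k + 2) (col r (Suc (Suc k)) 0) s2 s' \<and>
      incumbent r n B s' \<and> arr s2 2 0 \<le> arr s' 2 0 \<and>
      (\<forall>\<sigma>. reachable r n m (Suc k) (matrix_at r (Suc k) s2) (signs_at r (Suc k) s2) \<sigma> \<longrightarrow>
        quad_form r n B \<sigma> \<le> arr s' 2 0))"
    proof (rule Suc.IH[OF kr(2)])
      show "reg s2 0 = n" using K2 Suc.prems(2) by (simp add: keeps_def)
      show "matrix_at r 0 s2 i j = B i j" if "i < n" "j < r" for i j
        using keeps_matrix_at[OF K2, of 0 j i] Suc.prems(3) that by simp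
      show "incumbent r n B s2" using s1(1) s2 by (simp add: Inv_def incumbent_def)
      show "sign_vector n (signs_at r (Suc k) s2)"
        using el Suc.prems(5) \<delta> by (auto simp: eliminated_def sign_vector_def)
    qed
    then show "runs n (search r m (Suc k)) s2
      (\<lambda>s'. Inv s' \<and> reg s' (k + 2) = p \<and> arr s1 2 0 \<le> arr s' 2 0 \<and> found p (of_int \<delta>) s')"
    proof (rule runs_mono)
      fix s' assume s': "keeps (Suc k + 2) (col r (Suc (Suc k)) 0) s2 s' \<and>
        incumbent r n B s' \<and> arr s2 2 0 \<le> arr s' 2 0 \<and>
        (\<forall>\<sigma>. reachable r n m (Suc k) (matrix_at r (Suc k) s2) (signs_at r (Suc k) s2) \<sigma> \<longrightarrow>
          quad_form r n B \<sigma> \<le> arr s' 2 0)"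
      have "?K s2 s'" by (rule keeps_mono[OF conjunct1[OF s']]) (simp_all add: level_le)
      with K2 have "?K s s'" by (rule keeps_trans)
      moreover have "reg s' (k + 2) = p" using s' p2 by (simp add: keeps_def)
      moreover have "found p (of_int \<delta>) s'" using s' el unfolding found_def by blast
      ultimately show "Inv s' \<and> reg s' (k + 2) = p \<and> arr s1 2 0 \<le> arr s' 2 0 \<and> found p (of_int \<delta>) s'"
        using s' s2 s1(1) by (simp add: Inv_def)
    qed
  qed
  define P where "P p s' \<longleftrightarrow> Inv s' \<and> (\<forall>p'<p. found p' 1 s' \<and> found p' (-1) s')" for p s'
  \<comment> \<open>The stored maximum never decreases, so branches already explored stay
    dominated.\<close>
  have mono: "found p \<delta> s1 \<Longrightarrow> arr s1 2 0 \<le> arr s2 2 0 \<Longrightarrow> found p \<delta> s2" for p \<delta> s1 s2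
    unfolding found_def by force
  have upd: "found p \<delta> (s'\<lparr>reg := \<rho>\<rparr>) = found p \<delta> s'" for p \<delta> s' \<rho> by (simp add: found_def)
  have Inv_upd: "Inv (s'\<lparr>reg := (reg s')(k + 2 := x)\<rparr>) = Inv s'" for s' x
    by (auto simp: Inv_def keeps_def incumbent_def)
  have "runs n (search r (Suc m) k) s (P n)"
    unfolding search.simps
  proof (rule runs_for_rows)
    show "reg s 0 = n" by fact
    show "P 0 (s\<lparr>reg := (reg s)(k + 2 := 0)\<rparr>)"
      using Suc.prems(4) unfolding P_def Inv_upd by (simp add: Inv_def keeps_refl)
    fix p s1 assume p: "p < n" "P p s1" "reg s1 (k + 2) = p" "reg s1 0 = n"
    have "runs n (Seq (Seq (eliminate r k 1) (search r m (Suc k)))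
        (Seq (eliminate r k (- 1)) (search r m (Suc k)))) s1
        (\<lambda>s'. Inv s' \<and> reg s' (k + 2) = p \<and> arr s1 2 0 \<le> arr s' 2 0 \<and> found p 1 s' \<and> found p (- 1) s')"
    proof (rule runs_Seq)
      show "runs n (Seq (eliminate r k 1) (search r m (Suc k))) s1
        (\<lambda>s'. Inv s' \<and> reg s' (k + 2) = p \<and> arr s1 2 0 \<le> arr s' 2 0 \<and> found p (of_int 1) s')"
        by (rule branch) (use p in \<open>auto simp: P_def\<close>)
      fix s2 assume s2: "Inv s2 \<and> reg s2 (k + 2) = p \<and> arr s1 2 0 \<le> arr s2 2 0 \<and> found p (of_int 1) s2"
      then have "runs n (Seq (eliminate r k (- 1)) (search r m (Suc k))) s2
        (\<lambda>s'. Inv s' \<and> reg s' (k + 2) = p \<and> arr s2 2 0 \<le> arr s' 2 0 \<and> found p (of_int (- 1)) s')"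
        by (intro branch) auto
      then show "runs n (Seq (eliminate r k (- 1)) (search r m (Suc k))) s2
        (\<lambda>s'. Inv s' \<and> reg s' (k + 2) = p \<and> arr s1 2 0 \<le> arr s' 2 0 \<and> found p 1 s' \<and> found p (- 1) s')"
        by (rule runs_mono) (use s2 mono in auto)
    qed
    then show "runs n (Seq (Seq (eliminate r k 1) (search r m (Suc k)))
        (Seq (eliminate r k (- 1)) (search r m (Suc k)))) s1
        (\<lambda>s'. reg s' (k + 2) = p \<and> reg s' 0 = n \<and> P (Suc p) (s'\<lparr>reg := (reg s')(k + 2 := Suc p)\<rparr>))"
    proof (rule runs_mono)
      fix s' assume s': "Inv s' \<and> reg s' (k + 2) = p \<and> arr s1 2 0 \<le> arr s' 2 0 \<and>
        found p 1 s' \<and> found p (- 1) s'"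
      then have "reg s' 0 = n" using Suc.prems(2) by (simp add: Inv_def keeps_def)
      moreover have "found p' 1 s' \<and> found p' (- 1) s'" if "p' < Suc p" for p'
        using s' p(2) mono that by (auto simp: P_def less_Suc_eq)
      ultimately show "reg s' (k + 2) = p \<and> reg s' 0 = n \<and>
          P (Suc p) (s'\<lparr>reg := (reg s')(k + 2 := Suc p)\<rparr>)"
        using s' unfolding P_def upd Inv_upd by simp
    qed
  qed simp
  then show ?case
  proof (rule runs_mono)
    fix s' assume s': "P n s'"
    have "quad_form r n B \<sigma> \<le> arr s' 2 0" if "reachable r n (Suc m) k ?C ?X \<sigma>" for \<sigma>
    proof -
      from that obtain p \<delta> where p: "p < n" "\<delta> = 1 \<or> \<delta> = - 1"
        "\<forall>C' X'. eliminated r n k p \<delta> ?C ?X C' X' \<longrightarrow> reachable r n m (Suc k) C' X' \<sigma>"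
        by auto
      with s' have "found p \<delta> s'" by (auto simp: P_def)
      with p(3) show ?thesis by (simp add: found_def)
    qed
    with s' show "?K s s' \<and> incumbent r n B s' \<and> arr s 2 0 \<le> arr s' 2 0 \<and>
        (\<forall>\<sigma>. reachable r n (Suc m) k ?C ?X \<sigma> \<longrightarrow> quad_form r n B \<sigma> \<le> arr s' 2 0)"
      by (simp add: P_def Inv_def del: reachable.simps)
  qed
qed

section \<open>The whole program and the combined statement\<close>

text \<open>A case distinction replaces induction: the recursive call ranges over all results of
  \<open>eliminated\<close>, which reads only entries within range. For a successor,
  \<open>k + m = r\<close> places column \<open>k\<close> in range.\<close>

lemma reachable_cong:
  assumes "\<And>i j. i < n \<Longrightarrow> j < r \<Longrightarrow> C i j = D i j" "\<And>i. i < n \<Longrightarrow> X i = Y i"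
    and "k + m = r"
  shows "reachable r n m k C X \<sigma> \<longleftrightarrow> reachable r n m k D Y \<sigma>"
proof (cases m)
  case (Suc l)
  have "eliminated r n k p \<delta> C X C' X' \<longleftrightarrow> eliminated r n k p \<delta> D Y C' X'" if "p < n" for p \<delta> C' X'
    using assms that Suc by (auto simp: eliminated_def)
  then show ?thesis unfolding Suc reachable.simps by blast
qed (use assms in simp)

lemma runs_maximize:
  "runs n (maximize r) (quad_input r n B) (quad_output r n B)"
proof -
  let ?s = "quad_input r n B"
  let ?L = "\<lambda>s. reg s 0 = n \<and> (\<forall>i<n. (\<forall>j<r. matrix_at r 0 s i j = B i j) \<and> signs_at r 0 s i = 1)"
  have "arr ?s 0 (i * r + j) = B i j" if "i < n" "j < r" for i j
  proof -
    have "i * r + j < Suc i * r" using that(2) by simp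
    also have "\<dots> \<le> n * r" using that(1) by (intro mult_le_mono1) simp
    finally show ?thesis using that by (simp add: quad_input_def)
  qed
  then have load: "runs n (load r) ?s ?L"
    using runs_load[of ?s n r] by (auto elim!: runs_mono simp: quad_input_def matrix_at_def signs_at_def)
  have init: "runs n (RSet 2 (INum 0) (RNum (- 1))) s (\<lambda>s'. ?L s' \<and> arr s' 2 0 = - 1)" if "?L s" for s
    using that by (intro runs_RSet) (simp add: matrix_at_def signs_at_def)
  have ev: "runs n (evaluate r 0) s (\<lambda>s'. ?L s' \<and> incumbent r n B s' \<and>
      quad_form r n B (signs_at r 0 s') \<le> arr s' 2 0)" if "?L s \<and> arr s 2 0 = - 1" for s
  proof -
    have "runs n (evaluate r 0) s (\<lambda>s'. keeps 2 (col r (Suc 0) 0) s s' \<and> incumbent r n B s' \<and>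
        arr s 2 0 \<le> arr s' 2 0 \<and> quad_form r n B (signs_at r 0 s) \<le> arr s' 2 0)"
      by (rule runs_evaluate) (use that in \<open>auto simp: incumbent_def sign_vector_def\<close>)
    then show ?thesis
    proof (rule runs_mono)
      fix s' assume s': "keeps 2 (col r (Suc 0) 0) s s' \<and> incumbent r n B s' \<and>
        arr s 2 0 \<le> arr s' 2 0 \<and> quad_form r n B (signs_at r 0 s) \<le> arr s' 2 0"
      then have K: "keeps 2 (col r (Suc 0) 0) s s'" by blast
      have "matrix_at r 0 s' i j = matrix_at r 0 s i j" if "j < r" for i j
        using keeps_matrix_at[OF K] that by simp
      moreover have "signs_at r 0 s' = signs_at r 0 s" using keeps_signs_at[OF K] by simp
      moreover have "reg s' 0 = reg s 0" using K by (simp add: keeps_def)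
      ultimately show "?L s' \<and> incumbent r n B s' \<and> quad_form r n B (signs_at r 0 s') \<le> arr s' 2 0"
        using that s' by simp
    qed
  qed
  have se: "runs n (search r r 0) s (quad_output r n B)"
    if s: "?L s \<and> incumbent r n B s \<and> quad_form r n B (signs_at r 0 s) \<le> arr s 2 0" for s
  proof -
    have "runs n (search r r 0) s (\<lambda>s'. keeps (0 + 2) (col r (Suc 0) 0) s s' \<and> incumbent r n B s' \<and>
        arr s 2 0 \<le> arr s' 2 0 \<and>
        (\<forall>\<sigma>. reachable r n r 0 (matrix_at r 0 s) (signs_at r 0 s) \<sigma> \<longrightarrow> quad_form r n B \<sigma> \<le> arr s' 2 0))"
      by (rule runs_search) (use s in \<open>auto simp: sign_vector_def\<close>)
    then show ?thesis
    proof (rule runs_mono)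
      fix s' assume s': "keeps (0 + 2) (col r (Suc 0) 0) s s' \<and> incumbent r n B s' \<and>
        arr s 2 0 \<le> arr s' 2 0 \<and>
        (\<forall>\<sigma>. reachable r n r 0 (matrix_at r 0 s) (signs_at r 0 s) \<sigma> \<longrightarrow> quad_form r n B \<sigma> \<le> arr s' 2 0)"
      \<comment> \<open>The initial evaluation has left a nonnegative value, so the marker
        \<open>- 1\<close> is gone and array 1 holds a genuine candidate.\<close>
      have "0 \<le> quad_form r n B (signs_at r 0 s)" by (simp add: quad_form_eq_norm sum_nonneg)
      with s s' have out: "sign_vector n (arr s' 1)" "arr s' 2 0 = quad_form r n B (arr s' 1)"
        by (auto simp: incumbent_def)
      have "quad_form r n B y \<le> arr s' 2 0" if y: "sign_vector n y" for y
      \<comment> \<open>A pivot row exists only for positive \<open>n\<close>; without rows the form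
        is 0, which the stored value dominates.\<close>
      proof (cases "n = 0")
        case True
        with s s' show ?thesis by (simp add: quad_form_def)
      next
        case False
        then obtain \<sigma> where \<sigma>: "reachable r n r 0 B (\<lambda>_. 1) \<sigma>"
          "\<forall>y. sign_vector n y \<longrightarrow> quad_form r n B y \<le> quad_form r n B \<sigma>"
          using reachable_maximizer[of n r B] by blast
        have "reachable r n r 0 (matrix_at r 0 s) (signs_at r 0 s) \<sigma>"
          using \<sigma>(1) s by (subst reachable_cong[where D = B and Y = "\<lambda>_. 1"]) auto
        then have "quad_form r n B \<sigma> \<le> arr s' 2 0" using s' by blast
        with \<sigma>(2) y show ?thesis by force
      qed
      with out show "quad_output r n B s'" by (simp add: quad_output_def)
    qed
  qed
  show ?thesis
    unfolding maximize_def by (rule runs_Seq[OF load runs_Seq[OF init runs_Seq[OF ev se]]])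
qed

lemma quad_max_polytime: "quad_max_polytime r"
proof -
  have "\<exists>t s. exec (maximize r) (quad_input r n B) t s \<and> t \<le> poly (time_poly (maximize r)) n \<and>
      quad_output r n B s" for n B
    using runs_maximize[of n r B] by (simp add: runs_def)
  then show ?thesis
    unfolding quad_max_polytime_def polytime_solvable_def
    by (intro exI[of _ "maximize r"] exI[of _ "time_poly (maximize r)"]) auto
qed

theorem corollary5p1:
  fixes B :: "real^'r^'n" and n m d :: nat
  assumes "n = CARD('n)"
    and "m = card {i. row i B \<noteq> 0}"
    and "int d = aff_dim (zonotope B)"
  shows "zonotope B = (\<Sum>i\<in>UNIV. closed_segment (- row i B) (row i B)) \<and>
    (d = 0 \<longrightarrow> is_singleton (zonotope B) \<and> card (vert (zonotope B)) = 1) \<and>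
    (d \<ge> 1 \<longrightarrow>
       finite (vert (zonotope B)) \<and>
       card (vert (zonotope B)) \<le> 2 * (\<Sum>j=0..d-1. (m - 1) choose j) \<and>
       2 * (\<Sum>j=0..d-1. (m - 1) choose j) \<le> 2 * (\<Sum>j=0..d-1. (n - 1) choose j) \<and>
       (\<lambda>N. real (2 * (\<Sum>j=0..d-1. (N - 1) choose j))) \<in> O(\<lambda>N. real N ^ (d - 1)) \<and>
       (general_linear_position (\<lambda>i. row i B) {i. row i B \<noteq> 0}
          (span {x - y | x y. x \<in> zonotope B \<and> y \<in> zonotope B}) \<longrightarrow>
        card (vert (zonotope B)) = 2 * (\<Sum>j=0..d-1. (m - 1) choose j))) \<and>
    (\<forall>r. quad_max_polytime r)"
proof -
  have "aff_dim (zonotope B) = 0" if "d = 0" using assms(3) that by simp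
  then show ?thesis
    using zonotope_eq_sum_segments[of B] zonotope_point[of B] zonotope_vertices[OF assms]
      sum_binomial_bigo[of d] quad_max_polytime
    by blast
qed

end
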